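(* Let $(M,\phi,\xi,\eta,g)$ be a Kenmotsu manifold with a generalized symmetric metric connection $\bar\nabla$ of type $(\alpha,\beta)$, $\alpha\neq-1$, with curvature tensor $\bar R$ and Ricci tensor $\bar S$, satisfying $\bar S\cdot\bar R(\xi,X)=0$. Then every Ricci soliton $(g,\xi,\lambda)$ on $M$ (with respect to $\bar\nabla$) is either shrinking or expanding.
   Context: An almost contact metric manifold is a smooth manifold $M$ of odd dimension with a $(1,1)$-tensor field $\phi$, a vector field $\xi$, a 1-form $\eta$ and a Riemannian metric $g$ such that $\phi\xi=0$, $\eta(\phi X)=0$, $\eta(\xi)=1$, $\phi^2X=-X+\eta(X)\xi$, $g(\phi X,\phi Y)=g(X,Y)-\eta(X)\eta(Y)$, $g(X,\xi)=\eta(X)$. It is a Kenmotsu manifold if, with $\nabla$ the Levi-Civita connection, $(\nabla_X\phi)Y=g(\phi X,Y)\xi-\eta(Y)\phi X$ and $\nabla_X\xi=X-\eta(X)\xi$. For smooth functions $\alpha,\beta$ on $M$, the generalized symmetric metric connection of type $(\alpha,\beta)$ is the linear connection $\bar\nabla$ with $\bar\nabla g=0$ and torsion $T(X,Y)=\alpha\{\eta(Y)X-\eta(X)Y\}+\beta\{\eta(Y)\phi X-\eta(X)\phi Y\}$; explicitly $\bar\nabla_XY=\nabla_XY+\alpha\{\eta(Y)X-g(X,Y)\xi\}-\beta\eta(X)\phi Y$. Its curvature tensor is $\bar R(X,Y)Z=\bar\nabla_X\bar\nabla_YZ-\bar\nabla_Y\bar\nabla_XZ-\bar\nabla_{[X,Y]}Z$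 and its Ricci tensor is $\bar S(Y,Z)=\operatorname{trace}(X\mapsto\bar R(X,Y)Z)$. For real constants $\lambda,\mu$, the data $(g,\xi,\lambda,\mu)$ is an $\eta$-Ricci soliton on $M$ if $\mathcal L_\xi g+2\bar S+2\lambda g+2\mu\,\eta\otimes\eta=0$, where $\mathcal L_\xi g$ is written in terms of $\bar\nabla$, i.e. $2\bar S(X,Y)=-g(\bar\nabla_X\xi,Y)-g(X,\bar\nabla_Y\xi)-2\lambda g(X,Y)-2\mu\eta(X)\eta(Y)$ for all vector fields $X,Y$. If $\mu=0$, $(g,\xi,\lambda)$ is called a Ricci soliton; it is shrinking, steady or expanding according as $\lambda<0$, $\lambda=0$ or $\lambda>0$. The condition $\bar S\cdot\bar R(\xi,X)=0$ means that for all vector fields $X,Y,Z,W$ on $M$ $$\bar S(X,\bar R(Y,Z)W)\xi-\bar S(\xi,\bar R(Y,Z)W)X+\bar S(X,Y)\bar R(\xi,Z)W-\bar S(\xi,Y)\bar R(X,Z)W$$ $$+\bar S(X,Z)\bar R(Y,\xi)W-\bar S(\xi,Z)\bar R(Y,X)W+\bar S(X,W)\bar R(Y,Z)\xi-\bar S(\xi,W)\bar R(Y,Z)X=0.$$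
   Formalization: The manifold is assumed to have dimension at least 3, since in dimension 1 (the real line with φ = 0, η = dt, g = dt²) all hypotheses hold and the only Ricci soliton is steady. *)

theory Defs
  imports "HOL-Analysis.Analysis" "HOL-Library.Function_Algebras"
begin

section \<open>Smooth manifolds\<close>

text \<open>Differentiability of order \<open>k\<close> on an open set, by iterated directional derivatives.\<close>

primrec Ck_on :: "nat \<Rightarrow> 'b::real_normed_vector set \<Rightarrow> ('b \<Rightarrow> 'c::real_normed_vector) \<Rightarrow> bool" where
  "Ck_on 0 S f \<longleftrightarrow> continuous_on S f"
| "Ck_on (Suc k) S f \<longleftrightarrow>
     (\<forall>x\<in>S. f differentiable (at x)) \<and> (\<forall>v. Ck_on k S (\<lambda>x. frechet_derivative f (at x) v))"

definition smooth_on :: "'b::real_normed_vector set \<Rightarrow> ('b \<Rightarrow> 'c::real_normed_vector) \<Rightarrow> bool" where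
  "smooth_on S f \<longleftrightarrow> open S \<and> (\<forall>k. Ck_on k S f)"

text \<open>
  The underlying space of a manifold is a whole type \<open>'a\<close>, Hausdorff and second countable by its
  type class. A chart is a pair \<open>(U, h)\<close>; the values of \<open>h\<close> outside \<open>U\<close> are irrelevant.
  The dimension is \<open>DIM('e)\<close>. An atlas need not be maximal.
\<close>

type_synonym ('a, 'e) atlas = "('a set \<times> ('a \<Rightarrow> 'e)) set"

definition smooth_manifold ::
    "('a::{t2_space, second_countable_topology}, 'e::euclidean_space) atlas \<Rightarrow> bool" where
  "smooth_manifold A \<longleftrightarrow>
     (\<forall>(U, h)\<in>A. open U \<and> open (h ` U) \<and> homeomorphism U (h ` U) h (inv_into U h)) \<and>
     (\<Union>(U, h)\<in>A. U) = UNIV \<and>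
     (\<forall>(U, h)\<in>A. \<forall>(V, k)\<in>A. smooth_on (h ` (U \<inter> V)) (k \<circ> inv_into U h))"

definition smooth_fun ::
    "('a::{t2_space, second_countable_topology}, 'e::euclidean_space) atlas \<Rightarrow> ('a \<Rightarrow> real) \<Rightarrow> bool" where
  "smooth_fun A f \<longleftrightarrow> (\<forall>(U, h)\<in>A. smooth_on (h ` U) (f \<circ> inv_into U h))"


section \<open>Tangent vectors and vector fields\<close>

text \<open>
  A tangent vector at \<open>p\<close> is a derivation at \<open>p\<close> of the algebra of smooth functions. So that equality
  of tangent vectors is equality of functionals, it takes the value 0 on functions that are not smooth.
  Sums, differences, products and zero of functions, functionals and vector fields are the pointwise
  ones of \<^theory>\<open>HOL-Library.Function_Algebras\<close>.
\<close>

type_synonym 'a tvec = "('a \<Rightarrow> real) \<Rightarrow> real"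
type_synonym 'a vfield = "'a \<Rightarrow> 'a tvec"

definition tscale :: "real \<Rightarrow> 'a tvec \<Rightarrow> 'a tvec" where
  "tscale c v = (\<lambda>f. c * v f)"

global_interpretation tvec: vector_space tscale
  by unfold_locales (auto simp: tscale_def algebra_simps)

definition tangent_space ::
    "('a::{t2_space, second_countable_topology}, 'e::euclidean_space) atlas \<Rightarrow> 'a \<Rightarrow> 'a tvec set" where
  "tangent_space A p = {v.
     (\<forall>f g. smooth_fun A f \<longrightarrow> smooth_fun A g \<longrightarrow> v (f + g) = v f + v g) \<and>
     (\<forall>c f. smooth_fun A f \<longrightarrow> v (\<lambda>x. c * f x) = c * v f) \<and>
     (\<forall>f g. smooth_fun A f \<longrightarrow> smooth_fun A g \<longrightarrow> v (f * g) = f p * v g + g p * v f) \<and>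
     (\<forall>f. \<not> smooth_fun A f \<longrightarrow> v f = 0)}"

definition vector_field ::
    "('a::{t2_space, second_countable_topology}, 'e::euclidean_space) atlas \<Rightarrow> 'a vfield \<Rightarrow> bool" where
  "vector_field A X \<longleftrightarrow>
     (\<forall>p. X p \<in> tangent_space A p) \<and> (\<forall>f. smooth_fun A f \<longrightarrow> smooth_fun A (\<lambda>p. X p f))"

definition along :: "'a vfield \<Rightarrow> ('a \<Rightarrow> real) \<Rightarrow> 'a \<Rightarrow> real" where
  "along X f = (\<lambda>p. X p f)"

definition smul :: "('a \<Rightarrow> real) \<Rightarrow> 'a vfield \<Rightarrow> 'a vfield"  (infixr "\<odot>" 75) where
  "f \<odot> X = (\<lambda>p. tscale (f p) (X p))"

definition bracket :: "'a vfield \<Rightarrow> 'a vfield \<Rightarrow> 'a vfield" where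
  "bracket X Y = (\<lambda>p f. X p (along Y f) - Y p (along X f))"


section \<open>Tensor fields\<close>

text \<open>
  Tensor fields are families of multilinear maps on the tangent spaces; they are smooth if they turn
  smooth vector fields into smooth vector fields or smooth functions.
\<close>

definition app :: "('a \<Rightarrow> 'a tvec \<Rightarrow> 'b) \<Rightarrow> 'a vfield \<Rightarrow> 'a \<Rightarrow> 'b" where
  "app T X = (\<lambda>p. T p (X p))"

definition app2 :: "('a \<Rightarrow> 'a tvec \<Rightarrow> 'a tvec \<Rightarrow> 'b) \<Rightarrow> 'a vfield \<Rightarrow> 'a vfield \<Rightarrow> 'a \<Rightarrow> 'b" where
  "app2 T X Y = (\<lambda>p. T p (X p) (Y p))"

definition tensor11 ::
    "('a::{t2_space, second_countable_topology}, 'e::euclidean_space) atlas \<Rightarrow>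
     ('a \<Rightarrow> 'a tvec \<Rightarrow> 'a tvec) \<Rightarrow> bool" where
  "tensor11 A \<phi> \<longleftrightarrow>
     (\<forall>p. \<forall>v\<in>tangent_space A p. \<phi> p v \<in> tangent_space A p \<and>
        (\<forall>w\<in>tangent_space A p. \<phi> p (v + w) = \<phi> p v + \<phi> p w) \<and>
        (\<forall>c. \<phi> p (tscale c v) = tscale c (\<phi> p v))) \<and>
     (\<forall>X. vector_field A X \<longrightarrow> vector_field A (app \<phi> X))"

definition one_form ::
    "('a::{t2_space, second_countable_topology}, 'e::euclidean_space) atlas \<Rightarrow>
     ('a \<Rightarrow> 'a tvec \<Rightarrow> real) \<Rightarrow> bool" where
  "one_form A \<eta> \<longleftrightarrow>
     (\<forall>p. \<forall>v\<in>tangent_space A p.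
        (\<forall>w\<in>tangent_space A p. \<eta> p (v + w) = \<eta> p v + \<eta> p w) \<and>
        (\<forall>c. \<eta> p (tscale c v) = c * \<eta> p v)) \<and>
     (\<forall>X. vector_field A X \<longrightarrow> smooth_fun A (app \<eta> X))"

definition riemannian_metric ::
    "('a::{t2_space, second_countable_topology}, 'e::euclidean_space) atlas \<Rightarrow>
     ('a \<Rightarrow> 'a tvec \<Rightarrow> 'a tvec \<Rightarrow> real) \<Rightarrow> bool" where
  "riemannian_metric A g \<longleftrightarrow>
     (\<forall>p. \<forall>u\<in>tangent_space A p. \<forall>v\<in>tangent_space A p.
        g p u v = g p v u \<and>
        (\<forall>w\<in>tangent_space A p. g p (u + w) v = g p u v + g p w v) \<and>
        (\<forall>c. g p (tscale c u) v = c * g p u v)) \<and>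
     (\<forall>p. \<forall>v\<in>tangent_space A p. v \<noteq> 0 \<longrightarrow> g p v v > 0) \<and>
     (\<forall>X Y. vector_field A X \<longrightarrow> vector_field A Y \<longrightarrow> smooth_fun A (app2 g X Y))"


section \<open>Linear connections and curvature\<close>

text \<open>A connection \<open>D\<close> is applied as \<open>D X Y\<close>, the derivative of \<open>Y\<close> in the direction \<open>X\<close>.\<close>

definition linear_connection ::
    "('a::{t2_space, second_countable_topology}, 'e::euclidean_space) atlas \<Rightarrow>
     ('a vfield \<Rightarrow> 'a vfield \<Rightarrow> 'a vfield) \<Rightarrow> bool" where
  "linear_connection A D \<longleftrightarrow>
     (\<forall>X Y. vector_field A X \<longrightarrow> vector_field A Y \<longrightarrow>
        vector_field A (D X Y) \<and>
        (\<forall>Z. vector_field A Z \<longrightarrow> D (X + Z) Y = D X Y + D Z Y \<and> D X (Y + Z) = D X Y + D X Z) \<and>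
        (\<forall>f. smooth_fun A f \<longrightarrow>
           D (f \<odot> X) Y = f \<odot> D X Y \<and> D X (f \<odot> Y) = along X f \<odot> Y + f \<odot> D X Y))"

definition metric_connection ::
    "('a::{t2_space, second_countable_topology}, 'e::euclidean_space) atlas \<Rightarrow>
     ('a \<Rightarrow> 'a tvec \<Rightarrow> 'a tvec \<Rightarrow> real) \<Rightarrow> ('a vfield \<Rightarrow> 'a vfield \<Rightarrow> 'a vfield) \<Rightarrow> bool" where
  "metric_connection A g D \<longleftrightarrow> linear_connection A D \<and>
     (\<forall>X Y Z. vector_field A X \<longrightarrow> vector_field A Y \<longrightarrow> vector_field A Z \<longrightarrow>
        along X (app2 g Y Z) = app2 g (D X Y) Z + app2 g Y (D X Z))"

definition torsion ::
    "('a vfield \<Rightarrow> 'a vfield \<Rightarrow> 'a vfield) \<Rightarrow> 'a vfield \<Rightarrow> 'a vfield \<Rightarrow> 'a vfield" where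
  "torsion D X Y = D X Y - D Y X - bracket X Y"

definition levi_civita ::
    "('a::{t2_space, second_countable_topology}, 'e::euclidean_space) atlas \<Rightarrow>
     ('a \<Rightarrow> 'a tvec \<Rightarrow> 'a tvec \<Rightarrow> real) \<Rightarrow> ('a vfield \<Rightarrow> 'a vfield \<Rightarrow> 'a vfield) \<Rightarrow> bool" where
  "levi_civita A g D \<longleftrightarrow> metric_connection A g D \<and>
     (\<forall>X Y. vector_field A X \<longrightarrow> vector_field A Y \<longrightarrow> torsion D X Y = 0)"

definition curvature ::
    "('a vfield \<Rightarrow> 'a vfield \<Rightarrow> 'a vfield) \<Rightarrow> 'a vfield \<Rightarrow> 'a vfield \<Rightarrow> 'a vfield \<Rightarrow> 'a vfield" where
  "curvature D X Y Z = D X (D Y Z) - D Y (D X Z) - D (bracket X Y) Z"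

text \<open>The trace of a linear endomorphism \<open>L\<close> of a finite-dimensional space \<open>V\<close> of functionals.\<close>

definition trace_on :: "'a tvec set \<Rightarrow> ('a tvec \<Rightarrow> 'a tvec) \<Rightarrow> real" where
  "trace_on V L = (let B = (SOME B. tvec.independent B \<and> tvec.span B = V)
                   in \<Sum>b\<in>B. tvec.representation B (L b) b)"

text \<open>
  An operator \<open>F\<close> on vector fields that is linear over the smooth functions induces an endomorphism of
  each tangent space, which sends \<open>v\<close> to the value at \<open>p\<close> of \<open>F X\<close> for any field \<open>X\<close> with
  \<open>X p = v\<close>; such fields exist and the value does not depend on the choice.
\<close>

definition induced_endo ::
    "('a::{t2_space, second_countable_topology}, 'e::euclidean_space) atlas \<Rightarrow>
     ('a vfield \<Rightarrow> 'a vfield) \<Rightarrow> 'a \<Rightarrow> 'a tvec \<Rightarrow> 'a tvec" where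
  "induced_endo A F p v = (THE w. \<forall>X. vector_field A X \<longrightarrow> X p = v \<longrightarrow> F X p = w)"

definition ricci ::
    "('a::{t2_space, second_countable_topology}, 'e::euclidean_space) atlas \<Rightarrow>
     ('a vfield \<Rightarrow> 'a vfield \<Rightarrow> 'a vfield) \<Rightarrow> 'a vfield \<Rightarrow> 'a vfield \<Rightarrow> 'a \<Rightarrow> real" where
  "ricci A D Y Z =
     (\<lambda>p. trace_on (tangent_space A p) (induced_endo A (\<lambda>X. curvature D X Y Z) p))"


section \<open>Kenmotsu manifolds\<close>

definition almost_contact_metric ::
    "('a::{t2_space, second_countable_topology}, 'e::euclidean_space) atlas \<Rightarrow>
     ('a \<Rightarrow> 'a tvec \<Rightarrow> 'a tvec) \<Rightarrow> 'a vfield \<Rightarrow> ('a \<Rightarrow> 'a tvec \<Rightarrow> real) \<Rightarrow>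
     ('a \<Rightarrow> 'a tvec \<Rightarrow> 'a tvec \<Rightarrow> real) \<Rightarrow> bool" where
  "almost_contact_metric A \<phi> \<xi> \<eta> g \<longleftrightarrow>
     smooth_manifold A \<and> odd DIM('e) \<and>
     tensor11 A \<phi> \<and> vector_field A \<xi> \<and> one_form A \<eta> \<and> riemannian_metric A g \<and>
     app \<phi> \<xi> = 0 \<and> app \<eta> \<xi> = 1 \<and>
     (\<forall>X. vector_field A X \<longrightarrow>
        app \<eta> (app \<phi> X) = 0 \<and>
        app \<phi> (app \<phi> X) = - X + app \<eta> X \<odot> \<xi> \<and>
        app2 g X \<xi> = app \<eta> X) \<and>
     (\<forall>X Y. vector_field A X \<longrightarrow> vector_field A Y \<longrightarrow>
        app2 g (app \<phi> X) (app \<phi> Y) = app2 g X Y - app \<eta> X * app \<eta> Y)"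

text \<open>
  The Levi-Civita connection exists and is unique on vector fields, so the existential quantifier
  below just names it. The term \<open>D X (\<phi> Y) - \<phi> (D X Y)\<close> is \<open>(D\<^sub>X \<phi>) Y\<close>.
\<close>

definition kenmotsu ::
    "('a::{t2_space, second_countable_topology}, 'e::euclidean_space) atlas \<Rightarrow>
     ('a \<Rightarrow> 'a tvec \<Rightarrow> 'a tvec) \<Rightarrow> 'a vfield \<Rightarrow> ('a \<Rightarrow> 'a tvec \<Rightarrow> real) \<Rightarrow>
     ('a \<Rightarrow> 'a tvec \<Rightarrow> 'a tvec \<Rightarrow> real) \<Rightarrow> bool" where
  "kenmotsu A \<phi> \<xi> \<eta> g \<longleftrightarrow>
     almost_contact_metric A \<phi> \<xi> \<eta> g \<and>
     (\<exists>D. levi_civita A g D \<and>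
        (\<forall>X Y. vector_field A X \<longrightarrow> vector_field A Y \<longrightarrow>
           D X (app \<phi> Y) - app \<phi> (D X Y) = app2 g (app \<phi> X) Y \<odot> \<xi> - app \<eta> Y \<odot> app \<phi> X) \<and>
        (\<forall>X. vector_field A X \<longrightarrow> D X \<xi> = X - app \<eta> X \<odot> \<xi>))"

definition generalized_symmetric_metric_connection ::
    "('a::{t2_space, second_countable_topology}, 'e::euclidean_space) atlas \<Rightarrow>
     ('a \<Rightarrow> 'a tvec \<Rightarrow> 'a tvec) \<Rightarrow> ('a \<Rightarrow> 'a tvec \<Rightarrow> real) \<Rightarrow>
     ('a \<Rightarrow> 'a tvec \<Rightarrow> 'a tvec \<Rightarrow> real) \<Rightarrow> ('a \<Rightarrow> real) \<Rightarrow> ('a \<Rightarrow> real) \<Rightarrow>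
     ('a vfield \<Rightarrow> 'a vfield \<Rightarrow> 'a vfield) \<Rightarrow> bool" where
  "generalized_symmetric_metric_connection A \<phi> \<eta> g \<alpha> \<beta> D \<longleftrightarrow>
     smooth_fun A \<alpha> \<and> smooth_fun A \<beta> \<and> metric_connection A g D \<and>
     (\<forall>X Y. vector_field A X \<longrightarrow> vector_field A Y \<longrightarrow>
        torsion D X Y = \<alpha> \<odot> (app \<eta> Y \<odot> X - app \<eta> X \<odot> Y)
                      + \<beta> \<odot> (app \<eta> Y \<odot> app \<phi> X - app \<eta> X \<odot> app \<phi> Y))"


section \<open>Solitons\<close>

text \<open>
  The Lie derivative of \<open>g\<close> along \<open>\<xi>\<close> is expressed through the connection \<open>D\<close>, that is, as
  \<open>g (D X \<xi>) Y + g X (D Y \<xi>)\<close>. If \<open>D\<close> has torsion, this is not the usual Lie derivative.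
\<close>

definition eta_ricci_soliton ::
    "('a::{t2_space, second_countable_topology}, 'e::euclidean_space) atlas \<Rightarrow> 'a vfield \<Rightarrow>
     ('a \<Rightarrow> 'a tvec \<Rightarrow> real) \<Rightarrow> ('a \<Rightarrow> 'a tvec \<Rightarrow> 'a tvec \<Rightarrow> real) \<Rightarrow>
     ('a vfield \<Rightarrow> 'a vfield \<Rightarrow> 'a vfield) \<Rightarrow> real \<Rightarrow> real \<Rightarrow> bool" where
  "eta_ricci_soliton A \<xi> \<eta> g D l m \<longleftrightarrow>
     (\<forall>X Y. vector_field A X \<longrightarrow> vector_field A Y \<longrightarrow> (\<forall>p.
        2 * ricci A D X Y p =
          - app2 g (D X \<xi>) Y p - app2 g X (D Y \<xi>) p
          - 2 * l * app2 g X Y p - 2 * m * app \<eta> X p * app \<eta> Y p))"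

definition ricci_soliton ::
    "('a::{t2_space, second_countable_topology}, 'e::euclidean_space) atlas \<Rightarrow> 'a vfield \<Rightarrow>
     ('a \<Rightarrow> 'a tvec \<Rightarrow> real) \<Rightarrow> ('a \<Rightarrow> 'a tvec \<Rightarrow> 'a tvec \<Rightarrow> real) \<Rightarrow>
     ('a vfield \<Rightarrow> 'a vfield \<Rightarrow> 'a vfield) \<Rightarrow> real \<Rightarrow> bool" where
  "ricci_soliton A \<xi> \<eta> g D l \<longleftrightarrow> eta_ricci_soliton A \<xi> \<eta> g D l 0"

definition shrinking_ricci_soliton ::
    "('a::{t2_space, second_countable_topology}, 'e::euclidean_space) atlas \<Rightarrow> 'a vfield \<Rightarrow>
     ('a \<Rightarrow> 'a tvec \<Rightarrow> real) \<Rightarrow> ('a \<Rightarrow> 'a tvec \<Rightarrow> 'a tvec \<Rightarrow> real) \<Rightarrow>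
     ('a vfield \<Rightarrow> 'a vfield \<Rightarrow> 'a vfield) \<Rightarrow> real \<Rightarrow> bool" where
  "shrinking_ricci_soliton A \<xi> \<eta> g D l \<longleftrightarrow> ricci_soliton A \<xi> \<eta> g D l \<and> l < 0"

definition expanding_ricci_soliton ::
    "('a::{t2_space, second_countable_topology}, 'e::euclidean_space) atlas \<Rightarrow> 'a vfield \<Rightarrow>
     ('a \<Rightarrow> 'a tvec \<Rightarrow> real) \<Rightarrow> ('a \<Rightarrow> 'a tvec \<Rightarrow> 'a tvec \<Rightarrow> real) \<Rightarrow>
     ('a vfield \<Rightarrow> 'a vfield \<Rightarrow> 'a vfield) \<Rightarrow> real \<Rightarrow> bool" where
  "expanding_ricci_soliton A \<xi> \<eta> g D l \<longleftrightarrow> ricci_soliton A \<xi> \<eta> g D l \<and> l > 0"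

text \<open>The condition \<open>S \<cdot> R(\<xi>, X) = 0\<close> for the curvature \<open>R\<close> and the Ricci tensor \<open>S\<close> of \<open>D\<close>.\<close>

definition ricci_dot_curvature_zero ::
    "('a::{t2_space, second_countable_topology}, 'e::euclidean_space) atlas \<Rightarrow> 'a vfield \<Rightarrow>
     ('a vfield \<Rightarrow> 'a vfield \<Rightarrow> 'a vfield) \<Rightarrow> bool" where
  "ricci_dot_curvature_zero A \<xi> D \<longleftrightarrow>
     (let R = curvature D; S = ricci A D in
      \<forall>X Y Z W. vector_field A X \<longrightarrow> vector_field A Y \<longrightarrow> vector_field A Z \<longrightarrow> vector_field A W \<longrightarrow>
          S X (R Y Z W) \<odot> \<xi> - S \<xi> (R Y Z W) \<odot> X
        + S X Y \<odot> R \<xi> Z W - S \<xi> Y \<odot> R X Z W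
        + S X Z \<odot> R Y \<xi> W - S \<xi> Z \<odot> R Y X W
        + S X W \<odot> R Y Z \<xi> - S \<xi> W \<odot> R Y Z X = 0)"

end

theory Submission
  imports Defs
begin

text \<open>
  Suppose \<open>l = 0\<close>. The torsion formula gives
  \<open>g (D X \<xi>) Y + g X (D Y \<xi>) = 2 (1 + \<alpha>) k X Y\<close> with \<open>k = g - \<eta> \<otimes> \<eta>\<close>, so the soliton
  equation reads \<open>S = - (1 + \<alpha>) k\<close>; in particular \<open>S \<xi> = 0\<close>, and at a point \<open>p\<close> with
  \<open>\<alpha> p \<noteq> - 1\<close> the form \<open>S\<close> is definite on the kernel of \<open>\<eta>\<close>.
  Since \<open>D\<close> is metric, \<open>R Y Z \<xi>\<close> is orthogonal to \<open>\<xi>\<close>, so for \<open>W = \<xi>\<close> the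
  \<open>\<xi>\<close>-component of \<open>S \<cdot> R(\<xi>, X) = 0\<close> is \<open>S X (R Y Z \<xi>) = 0\<close>, and \<open>R Y Z \<xi>\<close>
  vanishes at \<open>p\<close>. By skew-symmetry \<open>R Y Z W\<close> is then orthogonal to \<open>\<xi>\<close> at \<open>p\<close> for all
  \<open>W\<close>, and the same argument gives \<open>R Y Z W = 0\<close> at \<open>p\<close>. Hence the Ricci trace \<open>S\<close> vanishes
  at \<open>p\<close>, which contradicts \<open>S = - (1 + \<alpha>) k\<close> as the dimension is at least 2.

  Because the trace is taken over all derivations at \<open>p\<close>, each of them has to be extended to a smooth
  vector field. This rests on Hadamard's lemma and bump functions.
\<close>

section \<open>Calculus of smooth functions\<close>

lemma Ck_on_SucD:
  assumes "Ck_on (Suc k) S f" "x \<in> S"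
  shows "(f has_derivative frechet_derivative f (at x)) (at x)"
  using assms by (simp add: frechet_derivative_works)

text \<open>A derivative at \<open>x\<close> sees the function near \<open>x\<close>. As
  \<open>S\<close> is open, agreement on \<open>S\<close> is agreement near each of its points, so
  it passes to the derivatives of every order.\<close>

lemma Ck_on_cong:
  assumes "open S" "\<And>x. x \<in> S \<Longrightarrow> f x = g x" "Ck_on k S f"
  shows "Ck_on k S g"
  using assms
proof (induction k arbitrary: f g)
  case 0
  then show ?case by (simp cong: continuous_on_cong)
next
  case (Suc k)
  have deriv: "(g has_derivative frechet_derivative f (at x)) (at x)" if "x \<in> S" for x
    by (rule has_derivative_transform_within_open[OF Ck_on_SucD[OF Suc.prems(3) that] \<open>open S\<close> that
          Suc.prems(2)])
  have eq: "frechet_derivative f (at x) v = frechet_derivative g (at x) v" if "x \<in> S" for x v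
    using frechet_derivative_at[OF deriv[OF that]] by simp
  have Ck: "Ck_on k S (\<lambda>x. frechet_derivative f (at x) v)" for v
    using Suc.prems(3) by simp
  have "Ck_on k S (\<lambda>x. frechet_derivative g (at x) v)" for v
    by (rule Suc.IH[OF \<open>open S\<close> eq Ck])
  with deriv show ?case by (auto simp: differentiable_def)
qed

text \<open>\<open>frechet_derivative\<close> is a choice operator. Uniqueness of the derivative
  lets an explicit formula \<open>f'\<close> take its place, which is how the inductions below apply
  differentiation rules.\<close>

lemma Ck_on_SucI:
  assumes "open S"
    and "\<And>x. x \<in> S \<Longrightarrow> (f has_derivative f' x) (at x)"
    and "\<And>v. Ck_on k S (\<lambda>x. f' x v)"
  shows "Ck_on (Suc k) S f"
proof -
  have "f' x v = frechet_derivative f (at x) v" if "x \<in> S" for x v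
    using frechet_derivative_at[OF assms(2)[OF that]] by simp
  then have "Ck_on k S (\<lambda>x. frechet_derivative f (at x) v)" for v
    by (rule Ck_on_cong[OF \<open>open S\<close> _ assms(3)])
  with assms(2) show ?thesis
    by (auto simp: differentiable_def)
qed

lemma Ck_on_subset: "Ck_on k S f \<Longrightarrow> T \<subseteq> S \<Longrightarrow> Ck_on k T f"
  by (induction k arbitrary: f) (auto intro: continuous_on_subset)

lemma Ck_on_local:
  assumes "\<And>x. x \<in> S \<Longrightarrow> \<exists>T. open T \<and> x \<in> T \<and> Ck_on k T f"
  shows "Ck_on k S f"
  using assms
proof (induction k arbitrary: f)
  case 0
  show ?case
    unfolding Ck_on.simps
  proof (rule continuous_at_imp_continuous_on, rule ballI)
    fix x assume "x \<in> S"
    from "0.prems"[OF this] obtain T where "open T" "x \<in> T" "continuous_on T f"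
      by auto
    then show "isCont f x"
      by (simp add: continuous_on_eq_continuous_at)
  qed
next
  case (Suc k)
  have "f differentiable (at x)" if "x \<in> S" for x
    using Suc.prems[OF that] by auto
  moreover have "Ck_on k S (\<lambda>x. frechet_derivative f (at x) v)" for v
  proof (rule Suc.IH)
    fix x assume "x \<in> S"
    from Suc.prems[OF this] show "\<exists>T. open T \<and> x \<in> T \<and>
        Ck_on k T (\<lambda>x. frechet_derivative f (at x) v)"
      by auto
  qed
  ultimately show ?case by simp
qed

text \<open>\<open>Ck_on (Suc k)\<close> does not mention continuity of \<open>f\<close> itself; the
  base case obtains it from differentiability.\<close>

lemma Ck_on_Suc_imp_Ck_on: "Ck_on (Suc k) S f \<Longrightarrow> Ck_on k S f"
proof (induction k arbitrary: f)
  case 0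
  then show ?case
    by (auto intro!: continuous_at_imp_continuous_on differentiable_imp_continuous_within)
next
  case (Suc k)
  then have "Ck_on (Suc k) S (\<lambda>x. frechet_derivative f (at x) v)" for v
    by simp
  with Suc show ?case by simp
qed

lemma Ck_on_continuous_on: "Ck_on k S f \<Longrightarrow> continuous_on S f"
  by (induction k) (simp_all del: Ck_on.simps(2) add: Ck_on_Suc_imp_Ck_on)

lemma Ck_on_const: "Ck_on k S (\<lambda>x. c)"
  by (induction k arbitrary: c) auto

lemma Ck_on_ident: "Ck_on k S (\<lambda>x. x)"
  by (cases k) (auto simp: Ck_on_const)

lemma Ck_on_bounded_linear:
  assumes "open S" "bounded_linear L" "Ck_on k S f"
  shows "Ck_on k S (\<lambda>x. L (f x))"
  using assms
proof (induction k arbitrary: f)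
  case 0
  then show ?case by (simp add: bounded_linear.continuous_on)
next
  case (Suc k)
  show ?case
  proof (rule Ck_on_SucI[OF \<open>open S\<close>])
    show "((\<lambda>x. L (f x)) has_derivative (\<lambda>v. L (frechet_derivative f (at x) v))) (at x)"
      if "x \<in> S" for x
      by (rule bounded_linear.has_derivative[OF \<open>bounded_linear L\<close> Ck_on_SucD[OF Suc.prems(3) that]])
    show "Ck_on k S (\<lambda>x. L (frechet_derivative f (at x) v))" for v
      using Suc.prems by (intro Suc.IH) auto
  qed
qed

lemma Ck_on_add:
  assumes "open S" "Ck_on k S f" "Ck_on k S g"
  shows "Ck_on k S (\<lambda>x. f x + g x)"
  using assms
proof (induction k arbitrary: f g)
  case 0
  then show ?case by (simp add: continuous_on_add)
next
  case (Suc k)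
  show ?case
  proof (rule Ck_on_SucI[OF \<open>open S\<close>])
    show "((\<lambda>x. f x + g x) has_derivative
        (\<lambda>v. frechet_derivative f (at x) v + frechet_derivative g (at x) v)) (at x)"
      if "x \<in> S" for x
      by (intro has_derivative_add Ck_on_SucD[OF Suc.prems(2) that] Ck_on_SucD[OF Suc.prems(3) that])
    show "Ck_on k S (\<lambda>x. frechet_derivative f (at x) v + frechet_derivative g (at x) v)" for v
      using Suc.prems by (intro Suc.IH) auto
  qed
qed

lemma Ck_on_sum:
  assumes "open S" "\<And>i. i \<in> I \<Longrightarrow> Ck_on k S (f i)"
  shows "Ck_on k S (\<lambda>x. \<Sum>i\<in>I. f i x)"
  using assms(2)
  by (induction I rule: infinite_finite_induct) (auto intro: Ck_on_const Ck_on_add \<open>open S\<close>)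

lemma Ck_on_bounded_bilinear:
  assumes "open S" "bounded_bilinear prd" "Ck_on k S f" "Ck_on k S g"
  shows "Ck_on k S (\<lambda>x. prd (f x) (g x))"
  using assms
proof (induction k arbitrary: f g)
  case 0
  then show ?case by (simp add: bounded_bilinear.continuous_on)
next
  case (Suc k)
  \<comment> \<open>The product rule multiplies each function by a derivative of the other, so the
    undifferentiated functions must also be available at order \<open>k\<close>.\<close>
  have "Ck_on k S f" "Ck_on k S g"
    using Suc.prems(3,4) by (auto intro: Ck_on_Suc_imp_Ck_on simp del: Ck_on.simps)
  note Ck = this Suc.prems(3,4)[THEN Ck_on.simps(2)[THEN iffD1], THEN conjunct2, rule_format]
  show ?case
  proof (rule Ck_on_SucI[OF \<open>open S\<close>])
    show "((\<lambda>x. prd (f x) (g x)) has_derivative (\<lambda>v. prd (f x) (frechet_derivative g (at x) v) +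
        prd (frechet_derivative f (at x) v) (g x))) (at x)" if "x \<in> S" for x
      by (rule bounded_bilinear.FDERIV[OF Suc.prems(2) Ck_on_SucD[OF Suc.prems(3) that]
            Ck_on_SucD[OF Suc.prems(4) that]])
    show "Ck_on k S (\<lambda>x. prd (f x) (frechet_derivative g (at x) v) +
        prd (frechet_derivative f (at x) v) (g x))" for v
      by (rule Ck_on_add[OF \<open>open S\<close> Suc.IH Suc.IH]) (fact Ck Suc.prems(1,2))+
  qed
qed

lemmas Ck_on_mult = Ck_on_bounded_bilinear[OF _ bounded_bilinear_mult]

lemma linear_eq_sum_Basis:
  fixes f :: "'c::euclidean_space \<Rightarrow> 'd::real_vector"
  assumes "linear f"
  shows "f v = (\<Sum>i\<in>Basis. (v \<bullet> i) *\<^sub>R f i)"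
proof -
  have "f v = f (\<Sum>i\<in>Basis. (v \<bullet> i) *\<^sub>R i)"
    by (simp only: euclidean_representation)
  then show ?thesis
    by (simp only: linear_sum[OF assms] linear_cmul[OF assms])
qed

text \<open>The chain rule differentiates \<open>u\<close> in a direction that varies with
  \<open>x\<close>, while \<open>Ck_on\<close> speaks of fixed directions. Expanding the direction
  in \<open>Basis\<close> leaves derivatives of \<open>u\<close> along fixed vectors with scalar
  coefficients, to which the induction hypothesis applies.\<close>

lemma Ck_on_compose:
  fixes f :: "'b::real_normed_vector \<Rightarrow> 'c::euclidean_space"
    and u :: "'c \<Rightarrow> 'd::real_normed_vector"
  assumes "open S" "Ck_on k S f" "Ck_on k T u" "f ` S \<subseteq> T"
  shows "Ck_on k S (\<lambda>x. u (f x))"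
  using assms
proof (induction k arbitrary: u)
  case 0
  then show ?case by (auto intro: continuous_on_compose2)
next
  case (Suc k)
  have T: "f x \<in> T" if "x \<in> S" for x
    using Suc.prems(4) that by blast
  let ?u = "\<lambda>y. frechet_derivative u (at y)" and ?f = "\<lambda>x. frechet_derivative f (at x)"
  have deriv: "((\<lambda>x. u (f x)) has_derivative (\<lambda>v. \<Sum>i\<in>Basis. (?f x v \<bullet> i) *\<^sub>R ?u (f x) i)) (at x)"
    if x: "x \<in> S" for x
  proof -
    have u: "(u has_derivative ?u (f x)) (at (f x))"
      by (rule Ck_on_SucD[OF Suc.prems(3) T[OF x]])
    have "?u (f x) (?f x v) = (\<Sum>i\<in>Basis. (?f x v \<bullet> i) *\<^sub>R ?u (f x) i)" for v
      using linear_eq_sum_Basis[OF linear_frechet_derivative[OF differentiableI[OF u]]] .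
    moreover have "((\<lambda>x. u (f x)) has_derivative (\<lambda>v. ?u (f x) (?f x v))) (at x)"
      by (rule has_derivative_compose[OF Ck_on_SucD[OF Suc.prems(2) x] u])
    ultimately show ?thesis by simp
  qed
  show ?case
  proof (rule Ck_on_SucI[OF \<open>open S\<close> deriv])
    show "Ck_on k S (\<lambda>x. \<Sum>i\<in>Basis. (?f x v \<bullet> i) *\<^sub>R ?u (f x) i)" for v
    proof (rule Ck_on_sum[OF \<open>open S\<close>])
      fix i :: 'c
      have "Ck_on k S (\<lambda>x. ?f x v)" "Ck_on k T (\<lambda>y. ?u y i)" "Ck_on k S f"
        using Suc.prems(2,3) Ck_on_Suc_imp_Ck_on[OF Suc.prems(2)] by auto
      then have "Ck_on k S (\<lambda>x. ?f x v \<bullet> i)" "Ck_on k S (\<lambda>x. ?u (f x) i)"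
        using Suc.prems(1,4) by (auto intro: Suc.IH Ck_on_bounded_linear[OF _ bounded_linear_inner_left])
      then show "Ck_on k S (\<lambda>x. (?f x v \<bullet> i) *\<^sub>R ?u (f x) i)"
        by (rule Ck_on_bounded_bilinear[OF \<open>open S\<close> bounded_bilinear_scaleR])
    qed
  qed
qed

section \<open>Closure properties of smooth functions on open sets\<close>

lemma smooth_on_cong:
  "smooth_on S f \<Longrightarrow> (\<And>x. x \<in> S \<Longrightarrow> f x = g x) \<Longrightarrow> smooth_on S g"
  unfolding smooth_on_def using Ck_on_cong[of S f g] by blast

lemma smooth_on_subset: "smooth_on S f \<Longrightarrow> open T \<Longrightarrow> T \<subseteq> S \<Longrightarrow> smooth_on T f"
  unfolding smooth_on_def using Ck_on_subset[of _ S f T] by blast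

lemma smooth_on_local:
  assumes "open S" "\<And>x. x \<in> S \<Longrightarrow> \<exists>T. x \<in> T \<and> smooth_on T f"
  shows "smooth_on S f"
  unfolding smooth_on_def
proof (intro conjI allI Ck_on_local)
  show "\<exists>T. open T \<and> x \<in> T \<and> Ck_on k T f" if "x \<in> S" for k x
    using assms(2)[OF that] by (auto simp: smooth_on_def)
qed (fact assms(1))

lemma smooth_on_add: "smooth_on S f \<Longrightarrow> smooth_on S g \<Longrightarrow> smooth_on S (\<lambda>x. f x + g x)"
  by (simp add: smooth_on_def Ck_on_add)

lemma smooth_on_mult:
  fixes f g :: "_ \<Rightarrow> real"
  shows "smooth_on S f \<Longrightarrow> smooth_on S g \<Longrightarrow> smooth_on S (\<lambda>x. f x * g x)"
  by (simp add: smooth_on_def Ck_on_mult)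

lemma smooth_on_const: "open S \<Longrightarrow> smooth_on S (\<lambda>x. c)"
  by (simp add: smooth_on_def Ck_on_const)

lemma smooth_on_inner_diff:
  fixes w c :: "'e::euclidean_space"
  assumes "open S"
  shows "smooth_on S (\<lambda>x. (x - c) \<bullet> w)"
  using Ck_on_add[OF assms Ck_on_bounded_linear[OF assms bounded_linear_inner_left Ck_on_ident]
      Ck_on_const, of _ w "- (c \<bullet> w)"] assms
  by (simp add: smooth_on_def inner_diff_left)

lemma smooth_on_compose:
  fixes f :: "'b::real_normed_vector \<Rightarrow> 'c::euclidean_space"
  assumes "smooth_on S f" "smooth_on T u" "f ` S \<subseteq> T"
  shows "smooth_on S (\<lambda>x. u (f x))"
  using assms Ck_on_compose[of S _ f T u] unfolding smooth_on_def by blast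

lemma smooth_on_frechet_derivative:
  assumes "smooth_on S f"
  shows "smooth_on S (\<lambda>x. frechet_derivative f (at x) v)"
  using assms Ck_on.simps(2)[of _ S f] unfolding smooth_on_def by blast

lemma smooth_on_has_derivative:
  assumes "smooth_on S f" "x \<in> S"
  shows "(f has_derivative frechet_derivative f (at x)) (at x)"
  using assms Ck_on_SucD unfolding smooth_on_def by blast

lemma smooth_on_continuous_on: "smooth_on S f \<Longrightarrow> continuous_on S f"
  unfolding smooth_on_def by (blast intro: Ck_on_continuous_on)

section \<open>Bump functions\<close>

text \<open>The case \<open>P = 1\<close> is the classical flat function. The polynomial factor
  makes the family closed under differentiation, so that smoothness can be proved by induction over
  all \<open>P\<close> at once.\<close>

definition flat :: "real poly \<Rightarrow> real \<Rightarrow> real" where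
  "flat P t = (if t > 0 then poly P (1 / t) * exp (- (1 / t)) else 0)"

lemma poly_times_exp_minus_tendsto_0: "((\<lambda>x::real. poly P x * exp (- x)) \<longlongrightarrow> 0) at_top"
proof -
  have "((\<lambda>x. \<Sum>i\<le>degree P. coeff P i * (x ^ i / exp x)) \<longlongrightarrow> (\<Sum>i\<le>degree P. coeff P i * 0)) at_top"
    by (intro tendsto_sum tendsto_mult tendsto_const tendsto_power_div_exp_0)
  moreover have "poly P x * exp (- x) = (\<Sum>i\<le>degree P. coeff P i * (x ^ i / exp x))" for x
    by (simp add: poly_altdef exp_minus sum_distrib_right divide_inverse mult.assoc)
  ultimately show ?thesis by simp
qed

text \<open>With \<open>s = 1 / t\<close> one has \<open>ds/dt = - s * s\<close>, so
  \<open>P(s) * exp (- s)\<close> has derivative \<open>s * s * (P(s) - P'(s)) * exp (- s)\<close>;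
  the polynomial \<open>[:0, 0, 1:]\<close> is the factor \<open>s * s\<close>. At 0 both sides are
  0, by exponential decay.\<close>

lemma flat_has_derivative:
  "(flat P has_field_derivative flat ([:0, 0, 1:] * (P - pderiv P)) t) (at t)"
proof -
  consider "t > 0" | "t < 0" | "t = 0" by linarith
  then show ?thesis
  proof cases
    case 1
    have "((\<lambda>t. poly P (1 / t) * exp (- (1 / t))) has_field_derivative
        (poly (pderiv P) (1 / t) * (- (1 / t\<^sup>2))) * exp (- (1 / t))
          + (exp (- (1 / t)) * (1 / t\<^sup>2)) * poly P (1 / t)) (at t)"
      using 1 by (intro derivative_eq_intros DERIV_chain2[OF poly_DERIV])
        (auto simp: power2_eq_square)
    then have "((\<lambda>t. poly P (1 / t) * exp (- (1 / t))) has_field_derivative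
        flat ([:0, 0, 1:] * (P - pderiv P)) t) (at t)"
      using 1 by (simp add: flat_def power2_eq_square field_simps)
    then show ?thesis
      by (rule has_field_derivative_transform_within_open[where S = "{0<..}"])
        (use 1 in \<open>auto simp: flat_def\<close>)
  next
    case 2
    have "((\<lambda>t. 0) has_field_derivative flat ([:0, 0, 1:] * (P - pderiv P)) t) (at t)"
      using 2 by (simp add: flat_def)
    then show ?thesis
      by (rule has_field_derivative_transform_within_open[where S = "{..<0}"])
        (use 2 in \<open>auto simp: flat_def\<close>)
  next
    case 3
    have "((\<lambda>h. flat P h / h) \<longlongrightarrow> 0) (at_right 0)"
    proof (rule Lim_transform_eventually)
      \<comment> \<open>With \<open>s = inverse h\<close>, dividing by \<open>h\<close> multiplies
        by \<open>s\<close>, and \<open>pCons 0 P\<close> is the polynomial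
        \<open>s * P(s)\<close>.\<close>
      show "((\<lambda>h. poly (pCons 0 P) (inverse h) * exp (- inverse h)) \<longlongrightarrow> 0) (at_right 0)"
        by (rule filterlim_compose[OF poly_times_exp_minus_tendsto_0 filterlim_inverse_at_top_right])
      show "\<forall>\<^sub>F h in at_right 0. poly (pCons 0 P) (inverse h) * exp (- inverse h) = flat P h / h"
        by (auto simp: eventually_at_filter flat_def divide_inverse)
    qed
    moreover have "((\<lambda>h. flat P h / h) \<longlongrightarrow> 0) (at_left 0)"
      by (rule Lim_transform_eventually[OF tendsto_const])
        (auto simp: eventually_at_filter flat_def)
    ultimately have "((\<lambda>h. flat P h / h) \<longlongrightarrow> 0) (at 0)"
      by (simp add: filterlim_split_at)
    then show ?thesis
      by (simp add: 3 DERIV_def) (simp add: flat_def)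
  qed
qed

lemma Ck_on_flat: "Ck_on k UNIV (flat P)"
proof (induction k arbitrary: P)
  case 0
  have "isCont (flat P) t" for t
    using flat_has_derivative by (rule DERIV_isCont)
  then show ?case by (simp add: continuous_at_imp_continuous_on)
next
  case (Suc k)
  show ?case
  proof (rule Ck_on_SucI[OF open_UNIV])
    show "(flat P has_derivative (\<lambda>v. flat ([:0, 0, 1:] * (P - pderiv P)) t * v)) (at t)" for t
      using flat_has_derivative[of P t] by (simp add: has_field_derivative_def)
    show "Ck_on k UNIV (\<lambda>t. flat ([:0, 0, 1:] * (P - pderiv P)) t * v)" for v
      by (rule Ck_on_mult[OF open_UNIV Suc Ck_on_const])
  qed
qed

text \<open>The squared distance keeps the function smooth at \<open>c\<close>, and the prefactor
  normalises the value at \<open>c\<close> to 1. There is no plateau around \<open>c\<close>, so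
  later arguments may use only the value at the centre.\<close>

definition bump :: "'e::euclidean_space \<Rightarrow> real \<Rightarrow> 'e \<Rightarrow> real" where
  "bump c r x = exp (1 / r\<^sup>2) * flat 1 (r\<^sup>2 - (dist c x)\<^sup>2)"

lemma bump_center: "r > 0 \<Longrightarrow> bump c r c = 1"
  by (simp add: bump_def flat_def flip: exp_add)

lemma bump_outside: "r \<ge> 0 \<Longrightarrow> x \<notin> ball c r \<Longrightarrow> bump c r x = 0"
  by (auto simp: bump_def flat_def dest!: power2_less_imp_less)

lemma smooth_on_bump: "smooth_on UNIV (bump c r)"
proof -
  have *: "Ck_on k UNIV (\<lambda>x. x - c)" for k
    using Ck_on_add[OF open_UNIV Ck_on_ident Ck_on_const, of k "- c"] by simp
  have "Ck_on k UNIV (\<lambda>x. (- 1) * ((x - c) \<bullet> (x - c)))" for k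
    by (intro Ck_on_mult Ck_on_bounded_bilinear[OF open_UNIV bounded_bilinear_inner] * Ck_on_const open_UNIV)
  then have "Ck_on k UNIV (\<lambda>x. r\<^sup>2 + (- 1) * ((x - c) \<bullet> (x - c)))" for k
    by (intro Ck_on_add Ck_on_const open_UNIV)
  then have **: "smooth_on UNIV (\<lambda>x. r\<^sup>2 - (dist c x)\<^sup>2)"
    by (simp add: smooth_on_def dist_norm norm_minus_commute[of c] power2_norm_eq_inner)
  have flat: "smooth_on UNIV (flat 1)"
    by (simp add: smooth_on_def Ck_on_flat)
  have "smooth_on UNIV (\<lambda>x. exp (1 / r\<^sup>2) * flat 1 (r\<^sup>2 - (dist c x)\<^sup>2))"
    by (rule smooth_on_mult[OF smooth_on_const[OF open_UNIV] smooth_on_compose[OF ** flat]]) simp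
  then show ?thesis
    by (rule smooth_on_cong) (simp add: bump_def)
qed


section \<open>Hadamard's lemma\<close>

lemma segment_in_ball:
  fixes c x :: "'e::euclidean_space"
  assumes "x \<in> ball c r" "t \<in> {0..1}"
  shows "c + t *\<^sub>R (x - c) \<in> ball c r"
proof -
  have "t * norm (x - c) \<le> norm (x - c)"
    using assms(2) by (simp add: mult_left_le_one_le)
  with assms show ?thesis
    by (simp add: dist_norm norm_minus_commute)
qed

lemma continuous_on_segment_compose:
  fixes f :: "'e::euclidean_space \<Rightarrow> 'b::real_normed_vector"
  assumes "continuous_on (ball c r) f"
  shows "continuous_on (ball c r \<times> {0..1}) (\<lambda>p. f (c + snd p *\<^sub>R (fst p - c)))"
  by (rule continuous_on_compose2[OF assms])
    (auto intro!: continuous_intros dest: segment_in_ball simp del: mem_ball)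

text \<open>Differentiation under the integral sign. Each derivative in \<open>x\<close> brings out
  one more factor \<open>t\<close> by the chain rule; the power \<open>t ^ m\<close> is there to
  keep the induction going.\<close>

lemma Ck_on_ray_integral:
  fixes f :: "'e::euclidean_space \<Rightarrow> real"
  assumes "Ck_on k (ball c r) f"
  shows "Ck_on k (ball c r) (\<lambda>x. integral {0..1} (\<lambda>t. t ^ m * f (c + t *\<^sub>R (x - c))))"
  using assms
proof (induction k arbitrary: m f)
  case 0
  then have "continuous_on (ball c r \<times> {0..1}) (\<lambda>p. snd p ^ m * f (c + snd p *\<^sub>R (fst p - c)))"
    by (auto intro!: continuous_intros continuous_on_segment_compose)
  then show ?case
    using integral_continuous_on_param[of "ball c r" 0 1 "\<lambda>x t. t ^ m * f (c + t *\<^sub>R (x - c))"]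
    by (simp add: case_prod_unfold)
next
  case (Suc k)
  let ?B = "ball c r" and ?p = "\<lambda>x t. c + t *\<^sub>R (x - c)"
  define f' where "f' y = frechet_derivative f (at y)" for y
  have f': "(f has_derivative f' y) (at y)" if "y \<in> ?B" for y
    unfolding f'_def by (rule Ck_on_SucD[OF Suc.prems that])
  have Ck: "Ck_on k ?B (\<lambda>y. f' y v)" for v
    using Suc.prems by (simp add: f'_def)
  have "continuous_on ?B f"
  proof (rule continuous_at_imp_continuous_on, rule ballI)
    show "isCont f y" if "y \<in> ?B" for y
      using f'[OF that] by (rule has_derivative_continuous)
  qed
  then have cont: "continuous_on (?B \<times> {0..1}) (\<lambda>p. snd p ^ m * f (?p (fst p) (snd p)))"
    by (auto intro!: continuous_intros continuous_on_segment_compose)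
  have cont': "continuous_on ?B (\<lambda>y. f' y v)" for v
    using Ck_on_continuous_on[OF Ck] .
  \<comment> \<open>This is the derivative in \<open>x\<close> of the integrand, as a bounded linear
    map, which is the form that \<open>leibniz_rule\<close> takes.\<close>
  define F where "F x t = t ^ Suc m *\<^sub>R Blinfun (f' (?p x t))" for x t
  have F_apply: "blinfun_apply (F x t) v = t ^ Suc m * f' (?p x t) v" if "x \<in> ?B" "t \<in> {0..1}" for x t v
    using has_derivative_bounded_linear[OF f'[OF segment_in_ball[OF that]]]
    by (simp add: F_def blinfun.scaleR_left bounded_linear_Blinfun_apply)
  \<comment> \<open>Continuity in the operator norm may be tested on basis vectors, because the
    domain is Euclidean.\<close>
  have cont_F: "continuous_on (?B \<times> {0..1}) (\<lambda>p. F (fst p) (snd p))"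
  proof (rule continuous_on_blinfun_componentwise)
    fix i :: 'e
    have "continuous_on (?B \<times> {0..1}) (\<lambda>p. snd p ^ Suc m * f' (?p (fst p) (snd p)) i)"
      by (intro continuous_intros continuous_on_segment_compose[OF cont'])
    then show "continuous_on (?B \<times> {0..1}) (\<lambda>p. blinfun_apply (F (fst p) (snd p)) i)"
      by (subst continuous_on_cong[OF refl]) (auto simp: F_apply simp del: mem_ball)
  qed
  show ?case
  proof (rule Ck_on_SucI[OF open_ball])
    fix x assume x: "x \<in> ?B"
    have slice: "continuous_on {0..1} (\<lambda>t. h y t)"
      if "continuous_on (?B \<times> {0..1}) (\<lambda>p. h (fst p) (snd p))" "y \<in> ?B"
      for y and h :: "'e \<Rightarrow> real \<Rightarrow> 'z::real_normed_vector"
      using that by (auto intro!: continuous_on_compose2[OF that(1), of "{0..1}" "Pair y", simplified]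
          continuous_intros)
    have "((\<lambda>x. integral (cbox 0 1) (\<lambda>t. t ^ m * f (?p x t))) has_derivative
        blinfun_apply (integral (cbox 0 1) (F x))) (at x within ?B)"
    proof (rule leibniz_rule)
      fix y t assume yt: "y \<in> ?B" "t \<in> cbox 0 (1::real)"
      then have "(f has_derivative f' (?p y t)) (at (?p y t))"
        by (intro f' segment_in_ball) auto
      moreover have "((\<lambda>y. ?p y t) has_derivative (\<lambda>v. t *\<^sub>R v)) (at y within ?B)"
        by (auto intro!: derivative_eq_intros)
      ultimately have "((\<lambda>y. f (?p y t)) has_derivative (\<lambda>v. f' (?p y t) (t *\<^sub>R v))) (at y within ?B)"
        using has_derivative_compose by blast
      then have "((\<lambda>y. t ^ m * f (?p y t)) has_derivative (\<lambda>v. t ^ m * f' (?p y t) (t *\<^sub>R v))) (at y within ?B)"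
        by (rule has_derivative_mult_right)
      moreover have "f' (?p y t) (t *\<^sub>R v) = t * f' (?p y t) v" for v
        using linear_cmul[OF has_derivative_linear[OF \<open>(f has_derivative f' (?p y t)) (at (?p y t))\<close>]]
        by simp
      moreover have "blinfun_apply (F y t) = (\<lambda>v. t ^ m * (t * f' (?p y t) v))"
        using yt by (intro ext) (simp add: F_apply mult_ac)
      ultimately show "((\<lambda>y. t ^ m * f (?p y t)) has_derivative blinfun_apply (F y t)) (at y within ?B)"
        by simp
    next
      fix y assume "y \<in> ?B"
      from slice[OF cont this] show "(\<lambda>t. t ^ m * f (?p y t)) integrable_on cbox 0 1"
        by (intro integrable_continuous) auto
    next
      show "continuous_on (?B \<times> cbox 0 1) (\<lambda>(x, t). F x t)"
        using cont_F by (simp add: case_prod_unfold)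
    qed (use x in auto)
    moreover have "blinfun_apply (integral (cbox 0 1) (F x)) =
        (\<lambda>v. integral {0..1} (\<lambda>t. t ^ Suc m * f' (?p x t) v))"
    proof
      fix v
      have "F x integrable_on cbox 0 1"
        using slice[OF cont_F x] by (intro integrable_continuous) auto
      then show "blinfun_apply (integral (cbox 0 1) (F x)) v =
          integral {0..1} (\<lambda>t. t ^ Suc m * f' (?p x t) v)"
        using x by (subst blinfun_apply_integral) (auto intro!: integral_cong simp: F_apply simp del: mem_ball)
    qed
    ultimately show "((\<lambda>x. integral {0..1} (\<lambda>t. t ^ m * f (?p x t))) has_derivative
        (\<lambda>v. integral {0..1} (\<lambda>t. t ^ Suc m * f' (?p x t) v))) (at x)"
      using x by (simp add: at_within_open[OF _ open_ball] del: mem_ball)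
  next
    show "Ck_on k ?B (\<lambda>x. integral {0..1} (\<lambda>t. t ^ Suc m * f' (?p x t) v))" for v
      by (rule Suc.IH[OF Ck])
  qed
qed

text \<open>Integrate the derivative of \<open>f\<close> along the segment from \<open>c\<close> to
  \<open>x\<close> and expand the direction \<open>x - c\<close> in \<open>Basis\<close>;
  \<open>G i\<close> is the mean of the \<open>i\<close>-th partial derivative over the segment. At
  \<open>x = c\<close> the segment is a point and the mean is the partial derivative itself.\<close>

lemma hadamard:
  fixes f :: "'e::euclidean_space \<Rightarrow> real"
  assumes f: "smooth_on (ball c r) f"
  obtains G where "\<And>i. smooth_on (ball c r) (G i)"
    and "\<And>x. x \<in> ball c r \<Longrightarrow> f x = f c + (\<Sum>i\<in>Basis. ((x - c) \<bullet> i) * G i x)"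
    and "\<And>i. G i c = frechet_derivative f (at c) i"
proof -
  let ?f' = "\<lambda>y. frechet_derivative f (at y)"
  define G where "G i x = integral {0..1} (\<lambda>t. ?f' (c + t *\<^sub>R (x - c)) i)" for i x
  have center: "G i c = ?f' c i" for i
    by (simp add: G_def)
  have smooth: "smooth_on (ball c r) (G i)" for i
    using smooth_on_frechet_derivative[OF f, of i] Ck_on_ray_integral[of _ c r "\<lambda>y. ?f' y i" 0]
    by (auto simp: smooth_on_def G_def[abs_def])
  have "f x = f c + (\<Sum>i\<in>Basis. ((x - c) \<bullet> i) * G i x)" if x: "x \<in> ball c r" for x
  proof -
    have 1: "((\<lambda>t. ?f' (c + t *\<^sub>R (x - c)) (x - c)) has_integral
        f (c + 1 *\<^sub>R (x - c)) - f (c + 0 *\<^sub>R (x - c))) {0..1}"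
    proof (rule fundamental_theorem_of_calculus)
      fix t :: real assume t: "t \<in> {0..1}"
      have d: "(f has_derivative ?f' (c + t *\<^sub>R (x - c))) (at (c + t *\<^sub>R (x - c)))"
        by (rule smooth_on_has_derivative[OF f segment_in_ball[OF x t]])
      have "((\<lambda>t. c + t *\<^sub>R (x - c)) has_derivative (\<lambda>s. s *\<^sub>R (x - c))) (at t within {0..1})"
        by (auto intro!: derivative_eq_intros)
      from has_derivative_compose[OF this d] linear_cmul[OF has_derivative_linear[OF d]]
      show "((\<lambda>t. f (c + t *\<^sub>R (x - c))) has_vector_derivative ?f' (c + t *\<^sub>R (x - c)) (x - c))
          (at t within {0..1})"
        by (simp add: has_vector_derivative_def)
    qed simp
    have 2: "((\<lambda>t. ?f' (c + t *\<^sub>R (x - c)) (x - c)) has_integral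
        (\<Sum>i\<in>Basis. ((x - c) \<bullet> i) * G i x)) {0..1}"
    proof (rule has_integral_eq[rotated])
      show "(\<Sum>i\<in>Basis. ((x - c) \<bullet> i) * ?f' (c + t *\<^sub>R (x - c)) i) = ?f' (c + t *\<^sub>R (x - c)) (x - c)"
        if "t \<in> {0..1}" for t
        using linear_eq_sum_Basis[OF has_derivative_linear[OF
              smooth_on_has_derivative[OF f segment_in_ball[OF x that]]], of "x - c"]
        by simp
      show "((\<lambda>t. \<Sum>i\<in>Basis. ((x - c) \<bullet> i) * ?f' (c + t *\<^sub>R (x - c)) i) has_integral
          (\<Sum>i\<in>Basis. ((x - c) \<bullet> i) * G i x)) {0..1}"
      proof (intro has_integral_sum has_integral_mult_right)
        fix i :: 'e
        have "continuous_on {0..1} (\<lambda>t. ?f' (c + t *\<^sub>R (x - c)) i)"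
          by (rule continuous_on_compose2[OF smooth_on_continuous_on[OF smooth_on_frechet_derivative[OF f]]])
            (auto intro!: continuous_intros dest: segment_in_ball[OF x] simp del: mem_ball)
        then show "((\<lambda>t. ?f' (c + t *\<^sub>R (x - c)) i) has_integral G i x) {0..1}"
          by (simp add: G_def integrable_continuous_interval integrable_integral)
      qed simp
    qed
    show ?thesis
      using has_integral_unique[OF 1 2] by simp
  qed
  from smooth this center show thesis
    by (rule that)
qed

section \<open>Smooth functions and vector fields on a manifold\<close>

lemma smooth_fun_add: "smooth_fun A f \<Longrightarrow> smooth_fun A g \<Longrightarrow> smooth_fun A (\<lambda>p. f p + g p)"
  by (auto simp: smooth_fun_def comp_def intro!: smooth_on_add)

lemma smooth_fun_mult: "smooth_fun A f \<Longrightarrow> smooth_fun A g \<Longrightarrow> smooth_fun A (\<lambda>p. f p * g p)"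
  by (auto simp: smooth_fun_def comp_def intro!: smooth_on_mult)

lemma smooth_fun_cmult:
  assumes "smooth_fun A f"
  shows "smooth_fun A (\<lambda>p. c * f p)"
proof -
  have "smooth_on (h ` U) (\<lambda>x. c * (f \<circ> inv_into U h) x)" if "(U, h) \<in> A" for U h
  proof -
    have "smooth_on (h ` U) (f \<circ> inv_into U h)"
      using assms that by (auto simp: smooth_fun_def)
    moreover from this have "smooth_on (h ` U) (\<lambda>x. c)"
      by (simp add: smooth_on_def Ck_on_const)
    ultimately show ?thesis by (rule smooth_on_mult[rotated])
  qed
  then show ?thesis by (auto simp: smooth_fun_def comp_def)
qed

lemma smooth_fun_diff:
  "smooth_fun A f \<Longrightarrow> smooth_fun A g \<Longrightarrow> smooth_fun A (\<lambda>p. f p - g p)"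
  using smooth_fun_add[OF _ smooth_fun_cmult[of A g "- 1"]] by simp

lemma tangent_add:
  "v \<in> tangent_space A p \<Longrightarrow> smooth_fun A f \<Longrightarrow> smooth_fun A g \<Longrightarrow> v (\<lambda>x. f x + g x) = v f + v g"
  unfolding tangent_space_def plus_fun_def by blast

lemma tangent_cmult: "v \<in> tangent_space A p \<Longrightarrow> smooth_fun A f \<Longrightarrow> v (\<lambda>x. c * f x) = c * v f"
  unfolding tangent_space_def by blast

lemma tangent_mult:
  "v \<in> tangent_space A p \<Longrightarrow> smooth_fun A f \<Longrightarrow> smooth_fun A g \<Longrightarrow>
    v (\<lambda>x. f x * g x) = f p * v g + g p * v f"
  unfolding tangent_space_def times_fun_def by blast

lemma tangent_not_smooth: "v \<in> tangent_space A p \<Longrightarrow> \<not> smooth_fun A f \<Longrightarrow> v f = 0"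
  unfolding tangent_space_def by blast

lemma tangent_spaceI:
  assumes "\<And>f g. smooth_fun A f \<Longrightarrow> smooth_fun A g \<Longrightarrow> v (\<lambda>x. f x + g x) = v f + v g"
    and "\<And>c f. smooth_fun A f \<Longrightarrow> v (\<lambda>x. c * f x) = c * v f"
    and "\<And>f g. smooth_fun A f \<Longrightarrow> smooth_fun A g \<Longrightarrow> v (\<lambda>x. f x * g x) = f p * v g + g p * v f"
    and "\<And>f. \<not> smooth_fun A f \<Longrightarrow> v f = 0"
  shows "v \<in> tangent_space A p"
  using assms unfolding tangent_space_def plus_fun_def times_fun_def by blast

lemma subspace_tangent_space: "tvec.subspace (tangent_space A p)"
proof (rule tvec.subspaceI)
  show "0 \<in> tangent_space A p"
    by (rule tangent_spaceI) auto
  show "v + w \<in> tangent_space A p" if "v \<in> tangent_space A p" "w \<in> tangent_space A p" for v w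
    using that by (intro tangent_spaceI)
      (simp_all add: tangent_add tangent_cmult tangent_mult tangent_not_smooth algebra_simps)
  show "tscale c v \<in> tangent_space A p" if "v \<in> tangent_space A p" for c v
    using that by (intro tangent_spaceI)
      (simp_all add: tscale_def tangent_add tangent_cmult tangent_mult tangent_not_smooth algebra_simps)
qed

lemma vector_field_tangent: "vector_field A X \<Longrightarrow> X p \<in> tangent_space A p"
  by (simp add: vector_field_def)

lemma along_apply: "along X f p = X p f"
  by (simp add: along_def)

lemma smooth_fun_along: "vector_field A X \<Longrightarrow> smooth_fun A f \<Longrightarrow> smooth_fun A (along X f)"
  by (simp add: vector_field_def along_def)

lemma vector_field_diff:
  assumes "vector_field A X" "vector_field A Y"
  shows "vector_field A (X - Y)"
  using assms tvec.subspace_diff[OF subspace_tangent_space[of A]]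
  by (auto simp: vector_field_def smooth_fun_diff)

section \<open>Charts, Lie brackets and extension by zero\<close>

locale manifold =
  fixes A :: "('a::{t2_space, second_countable_topology}, 'e::euclidean_space) atlas"
  assumes manifold: "smooth_manifold A"
begin

lemma chart_open: "(U, h) \<in> A \<Longrightarrow> open (h ` U)"
  and chart_homeomorphism: "(U, h) \<in> A \<Longrightarrow> homeomorphism U (h ` U) h (inv_into U h)"
  and transition_smooth:
    "(U, h) \<in> A \<Longrightarrow> (V, k) \<in> A \<Longrightarrow> smooth_on (h ` (U \<inter> V)) (k \<circ> inv_into U h)"
  using manifold unfolding smooth_manifold_def by blast+

lemma chart_inverse: "(U, h) \<in> A \<Longrightarrow> q \<in> U \<Longrightarrow> inv_into U h (h q) = q"
  using chart_homeomorphism[of U h] by (simp add: homeomorphism_def)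

lemma smooth_fun_const: "smooth_fun A (\<lambda>p. c)"
  by (auto simp: smooth_fun_def comp_def intro!: smooth_on_const chart_open)

lemma smooth_fun_sum:
  "finite I \<Longrightarrow> (\<And>i. i \<in> I \<Longrightarrow> smooth_fun A (f i)) \<Longrightarrow> smooth_fun A (\<lambda>p. \<Sum>i\<in>I. f i p)"
  by (induction I rule: finite_induct) (auto intro: smooth_fun_const smooth_fun_add)

lemma tangent_sum:
  assumes "v \<in> tangent_space A p" "finite I" "\<And>i. i \<in> I \<Longrightarrow> smooth_fun A (f i)"
  shows "v (\<lambda>q. \<Sum>i\<in>I. f i q) = (\<Sum>i\<in>I. v (f i))"
  using assms(2,3)
proof (induction I rule: finite_induct)
  case empty
  then show ?case
    using tangent_cmult[OF assms(1) smooth_fun_const, of 0] by simp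
next
  case (insert i I)
  then show ?case
    by (simp add: tangent_add[OF assms(1)] smooth_fun_sum)
qed

lemma vector_field_bracket:
  assumes X: "vector_field A X" and Y: "vector_field A Y"
  shows "vector_field A (bracket X Y)"
proof -
  have *: "along X (\<lambda>q. f q + g q) = (\<lambda>q. along X f q + along X g q)"
    "along X (\<lambda>q. c * f q) = (\<lambda>q. c * along X f q)"
    "along X (\<lambda>q. f q * g q) = (\<lambda>q. f q * along X g q + g q * along X f q)"
    if "vector_field A X" "smooth_fun A f" "smooth_fun A g" for X f g c
    using that by (simp_all add: along_def tangent_add[OF vector_field_tangent]
        tangent_cmult[OF vector_field_tangent] tangent_mult[OF vector_field_tangent])
  have along_0: "along X f = (\<lambda>q. 0)" if "vector_field A X" "\<not> smooth_fun A f" for X f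
    using that by (auto simp: along_def tangent_not_smooth[OF vector_field_tangent])
  have at_0: "X p (\<lambda>q. 0) = 0" if "vector_field A X" for X p
    using tangent_cmult[OF vector_field_tangent[OF that] smooth_fun_const, where c = 0] by simp
  \<comment> \<open>Tangent vectors are 0 on functions that are not smooth by convention, and the
    bracket has to inherit this.\<close>
  have not_smooth: "bracket X Y p f = 0" if "\<not> smooth_fun A f" for p f
    unfolding bracket_def along_0[OF X that] along_0[OF Y that] at_0[OF X] at_0[OF Y] by simp
  note T = vector_field_tangent[OF X] vector_field_tangent[OF Y]
  note S = smooth_fun_along[OF X] smooth_fun_along[OF Y]
  have "bracket X Y p \<in> tangent_space A p" for p
  proof (rule tangent_spaceI)
    fix f g assume fg: "smooth_fun A f" "smooth_fun A g"
    show "bracket X Y p (\<lambda>q. f q + g q) = bracket X Y p f + bracket X Y p g"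
      unfolding bracket_def *(1)[OF X fg] *(1)[OF Y fg]
      by (simp add: T[THEN tangent_add] S fg)
    \<comment> \<open>Expanding both orders of differentiation, the products of a derivative of
      \<open>f\<close> with a derivative of \<open>g\<close> are symmetric in \<open>X\<close> and
      \<open>Y\<close> and cancel.\<close>
    show "bracket X Y p (\<lambda>q. f q * g q) = f p * bracket X Y p g + g p * bracket X Y p f"
      unfolding bracket_def *(3)[OF X fg] *(3)[OF Y fg]
      by (simp add: T[THEN tangent_add] T[THEN tangent_mult] S fg smooth_fun_mult)
        (simp add: along_def algebra_simps)
  next
    fix c f assume f: "smooth_fun A f"
    show "bracket X Y p (\<lambda>q. c * f q) = c * bracket X Y p f"
      unfolding bracket_def *(2)[OF X f f] *(2)[OF Y f f]
      by (simp add: T[THEN tangent_cmult] S f right_diff_distrib)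
  qed (rule not_smooth)
  moreover have "smooth_fun A (\<lambda>p. bracket X Y p f)" if "smooth_fun A f" for f
    using X Y that smooth_fun_along[OF X smooth_fun_along[OF Y that]]
      smooth_fun_along[OF Y smooth_fun_along[OF X that]]
    by (simp add: bracket_def along_def smooth_fun_diff)
  ultimately show ?thesis by (simp add: vector_field_def)
qed

text \<open>Smoothness is checked near each point of an arbitrary chart \<open>V\<close>. Where
  \<open>u\<close> is used, the function is \<open>u\<close> after a transition map. Elsewhere the
  point lies outside the preimage of \<open>K\<close>, which is compact and so closed in a Hausdorff
  space, and the function vanishes on the open complement.\<close>

lemma smooth_fun_extend_by_zero:
  fixes u :: "'e \<Rightarrow> real"
  assumes U: "(U, h) \<in> A" and u: "smooth_on W u" and W: "W \<subseteq> h ` U"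
    and K: "compact K" "K \<subseteq> W" "\<And>x. x \<in> W - K \<Longrightarrow> u x = 0"
  shows "smooth_fun A (\<lambda>q. if q \<in> U \<and> h q \<in> W then u (h q) else 0)"
    (is "smooth_fun A ?f")
  unfolding smooth_fun_def
proof clarify
  fix V k assume V: "(V, k) \<in> A"
  let ?\<psi> = "inv_into V k" and ?C = "inv_into U h ` K"
  have cont: "continuous_on (k ` V) ?\<psi>" and contU: "continuous_on (h ` U) (inv_into U h)"
    using chart_homeomorphism[OF V] chart_homeomorphism[OF U] by (auto simp: homeomorphism_def)
  have "compact ?C"
    by (rule compact_continuous_image[OF continuous_on_subset[OF contU] \<open>compact K\<close>])
      (use K W in auto)
  then have "closed ?C" by (rule compact_imp_closed)
  have open_W: "open W"
    using u by (simp add: smooth_on_def)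
  show "smooth_on (k ` V) (?f \<circ> ?\<psi>)"
  proof (rule smooth_on_local[OF chart_open[OF V]])
    fix y assume "y \<in> k ` V"
    then obtain q where q: "q \<in> V" "y = k q" by blast
    show "\<exists>T. y \<in> T \<and> smooth_on T (?f \<circ> ?\<psi>)"
    proof (cases "q \<in> U \<and> h q \<in> W")
      case True
      define T where "T = k ` (V \<inter> U) \<inter> (h \<circ> ?\<psi>) -` W"
      have \<tau>: "smooth_on (k ` (V \<inter> U)) (h \<circ> ?\<psi>)"
        by (rule transition_smooth[OF V U])
      then have "open T"
        unfolding T_def
        by (intro continuous_open_preimage smooth_on_continuous_on open_W)
          (auto simp: smooth_on_def)
      then have "smooth_on T (\<lambda>y. u ((h \<circ> ?\<psi>) y))"
        by (intro smooth_on_compose[OF smooth_on_subset[OF \<tau>] u]) (auto simp: T_def)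
      then have "smooth_on T (?f \<circ> ?\<psi>)"
        by (rule smooth_on_cong) (auto simp: T_def chart_inverse[OF V])
      moreover have "y \<in> T"
        using True q by (auto simp: T_def chart_inverse[OF V])
      ultimately show ?thesis by blast
    next
      case False
      define T where "T = k ` V \<inter> ?\<psi> -` (- ?C)"
      have "open T"
        unfolding T_def using \<open>closed ?C\<close> by (intro continuous_open_preimage cont chart_open[OF V]) auto
      then have "smooth_on T (\<lambda>y. 0 :: real)"
        by (rule smooth_on_const)
      then have "smooth_on T (?f \<circ> ?\<psi>)"
      proof (rule smooth_on_cong)
        fix y assume "y \<in> T"
        then have "?\<psi> y \<notin> ?C" by (simp add: T_def)
        then have "h (?\<psi> y) \<notin> K" if "?\<psi> y \<in> U"
          using chart_inverse[OF U that] by (metis imageI)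
        then show "0 = (?f \<circ> ?\<psi>) y"
          using K(3) by auto
      qed
      moreover have "q \<notin> ?C"
      proof
        assume "q \<in> ?C"
        then obtain x where x: "x \<in> K" "q = inv_into U h x" by blast
        with K W have "x \<in> h ` U" by blast
        with x have "q \<in> U" "h q = x"
          by (auto simp: inv_into_into f_inv_into_f)
        with False x(1) K(2) show False by auto
      qed
      then have "y \<in> T"
        using q by (simp add: T_def chart_inverse[OF V])
      ultimately show ?thesis by blast
    qed
  qed
qed

end

text \<open>
  The objects below are cut off by a bump function with support in the closed ball of radius \<open>r / 2\<close>,
  which makes them global; at the centre of the ball the cut-off is invisible.
\<close>

locale chart_ball = manifold A
  for A :: "('a::{t2_space, second_countable_topology}, 'e::euclidean_space) atlas" +
  fixes U :: "'a set" and h :: "'a \<Rightarrow> 'e" and p :: 'a and r :: real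
  assumes chart: "(U, h) \<in> A" and p_in_U: "p \<in> U" and r_pos: "r > 0" and ball_subset: "ball (h p) r \<subseteq> h ` U"
begin

abbreviation W :: "'e set" where "W \<equiv> ball (h p) r"

abbreviation \<rho> :: "'e \<Rightarrow> real" where "\<rho> \<equiv> bump (h p) (r / 2)"

definition extend :: "('e \<Rightarrow> real) \<Rightarrow> 'a \<Rightarrow> real" where
  "extend u q = (if q \<in> U \<and> h q \<in> W then \<rho> (h q) * u (h q) else 0)"

definition coord :: "'e \<Rightarrow> 'a \<Rightarrow> real" where
  "coord i = extend (\<lambda>x. (x - h p) \<bullet> i)"

text \<open>The constant field \<open>w\<close> of the chart, cut off to be global. The case
  distinction matches the convention that tangent vectors are 0 on functions that are not
  smooth.\<close>

definition coord_field :: "'e \<Rightarrow> 'a vfield" where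
  "coord_field w q f =
     (if smooth_fun A f then extend (\<lambda>x. frechet_derivative (f \<circ> inv_into U h) (at x) w) q else 0)"

lemma smooth_fun_extend:
  assumes "smooth_on W u"
  shows "smooth_fun A (extend u)"
proof -
  have "smooth_on W (\<lambda>x. \<rho> x * u x)"
    using r_pos by (intro smooth_on_mult smooth_on_subset[OF smooth_on_bump] assms) auto
  then have "smooth_fun A (\<lambda>q. if q \<in> U \<and> h q \<in> W then \<rho> (h q) * u (h q) else 0)"
  proof (rule smooth_fun_extend_by_zero[OF chart _ ball_subset, of _ "cball (h p) (r / 2)"])
    show "\<rho> x * u x = 0" if "x \<in> W - cball (h p) (r / 2)" for x
      using that r_pos bump_outside[of "r / 2" x "h p"] by auto
  qed (use r_pos in auto)
  then show ?thesis by (simp add: extend_def[abs_def])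
qed

lemma extend_center: "extend u p = u (h p)"
  using r_pos p_in_U by (simp add: extend_def bump_center)

lemma smooth_fun_coord: "smooth_fun A (coord i)"
  unfolding coord_def by (intro smooth_fun_extend smooth_on_inner_diff) simp

lemma local_smooth: "smooth_fun A f \<Longrightarrow> smooth_on W (f \<circ> inv_into U h)"
  using chart ball_subset by (auto simp: smooth_fun_def intro: smooth_on_subset)

lemma vector_field_coord_field: "vector_field A (coord_field w)"
proof -
  let ?\<psi> = "inv_into U h"
  have "coord_field w q \<in> tangent_space A q" for q
  proof (cases "q \<in> U \<and> h q \<in> W")
    case False
    then have "coord_field w q = (\<lambda>f. 0)"
      by (auto simp: coord_field_def extend_def)
    then show ?thesis by (auto intro: tangent_spaceI)
  next
    case True
    have deriv: "((f \<circ> ?\<psi>) has_derivative frechet_derivative (f \<circ> ?\<psi>) (at (h q))) (at (h q))"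
      if "smooth_fun A f" for f
      using smooth_on_has_derivative[OF local_smooth[OF that]] True by blast
    have q: "?\<psi> (h q) = q"
      using True by (intro chart_inverse[OF chart]) simp
    \<comment> \<open>Stated for any derivative \<open>D\<close> of \<open>f\<close> in the chart,
      so that the sum and product rules can be inserted directly.\<close>
    have val: "coord_field w q f = \<rho> (h q) * D w"
      if "smooth_fun A f" "(f \<circ> ?\<psi> has_derivative D) (at (h q))" for f D
      using True that frechet_derivative_at[OF that(2)] by (simp add: coord_field_def extend_def)
    have val0: "coord_field w q f = \<rho> (h q) * frechet_derivative (f \<circ> ?\<psi>) (at (h q)) w"
      if "smooth_fun A f" for f
      by (rule val[OF that deriv[OF that]])
    show ?thesis
    proof (rule tangent_spaceI)
      fix f g assume fg: "smooth_fun A f" "smooth_fun A g"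
      have "((\<lambda>x. f x + g x) \<circ> ?\<psi> has_derivative (\<lambda>v. frechet_derivative (f \<circ> ?\<psi>) (at (h q)) v
          + frechet_derivative (g \<circ> ?\<psi>) (at (h q)) v)) (at (h q))"
        using has_derivative_add[OF deriv[OF fg(1)] deriv[OF fg(2)]] by (simp add: comp_def)
      from val[OF smooth_fun_add[OF fg] this]
      show "coord_field w q (\<lambda>x. f x + g x) = coord_field w q f + coord_field w q g"
        by (simp add: val0 fg algebra_simps)
      have "((\<lambda>x. f x * g x) \<circ> ?\<psi> has_derivative (\<lambda>v. f q * frechet_derivative (g \<circ> ?\<psi>) (at (h q)) v
          + frechet_derivative (f \<circ> ?\<psi>) (at (h q)) v * g q)) (at (h q))"
        using has_derivative_mult[OF deriv[OF fg(1)] deriv[OF fg(2)]] by (simp add: comp_def q)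
      from val[OF smooth_fun_mult[OF fg] this]
      show "coord_field w q (\<lambda>x. f x * g x) = f q * coord_field w q g + g q * coord_field w q f"
        by (simp add: val0 fg algebra_simps)
    next
      fix c f assume f: "smooth_fun A f"
      have "((\<lambda>x. c * f x) \<circ> ?\<psi> has_derivative (\<lambda>v. c * frechet_derivative (f \<circ> ?\<psi>) (at (h q)) v)) (at (h q))"
        using has_derivative_mult_right[OF deriv[OF f], of c] by (simp add: comp_def)
      from val[OF smooth_fun_cmult[OF f] this]
      show "coord_field w q (\<lambda>x. c * f x) = c * coord_field w q f"
        by (simp add: val0 f)
    qed (simp add: coord_field_def)
  qed
  moreover have "smooth_fun A (\<lambda>q. coord_field w q f)" if "smooth_fun A f" for f
    using that smooth_fun_extend[OF smooth_on_frechet_derivative[OF local_smooth[OF that], of w]]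
    by (simp add: coord_field_def)
  ultimately show ?thesis by (simp add: vector_field_def)
qed

text \<open>By the product rule the derivative of the cut-off is multiplied by
  \<open>(x - h p) \<bullet> i\<close>, which vanishes at the centre. Thus \<open>w\<close> can be
  recovered from the values of its field on the coordinates.\<close>

lemma coord_field_coord: "coord_field w p (coord i) = w \<bullet> i"
proof -
  let ?u = "\<lambda>x. \<rho> x * ((x - h p) \<bullet> i)"
  have hp: "h p \<in> W" using r_pos by simp
  have "(\<rho> has_derivative frechet_derivative \<rho> (at (h p))) (at (h p))"
    using smooth_on_has_derivative[OF smooth_on_bump] by blast
  then have "(?u has_derivative (\<lambda>v. \<rho> (h p) * (v \<bullet> i) + frechet_derivative \<rho> (at (h p)) v * ((h p - h p) \<bullet> i)))
      (at (h p))"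
    by (intro has_derivative_mult) (auto intro!: derivative_eq_intros)
  then have u: "(?u has_derivative (\<lambda>v. v \<bullet> i)) (at (h p))"
    using r_pos by (simp add: bump_center)
  have "?u x = (coord i \<circ> inv_into U h) x" if "x \<in> W" for x
    using that ball_subset
    by (auto simp: coord_def extend_def inv_into_into f_inv_into_f simp del: mem_ball)
  from has_derivative_transform_within_open[OF u open_ball hp this]
  have "(coord i \<circ> inv_into U h has_derivative (\<lambda>v. v \<bullet> i)) (at (h p))" .
  from frechet_derivative_at[OF this, THEN fun_cong, of w] show ?thesis
    by (simp add: coord_field_def smooth_fun_coord extend_center)
qed

text \<open>Apply \<open>v\<close> to Hadamard's expansion of \<open>f\<close>. The product rule
  leaves one term per coordinate, since \<open>coord i\<close> vanishes at \<open>p\<close> and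
  \<open>extend (G i)\<close> has there the value of the partial derivative.\<close>

lemma tangent_eq_sum_coord:
  assumes v: "v \<in> tangent_space A p" and f: "smooth_fun A f"
  shows "v f = (\<Sum>i\<in>Basis. v (coord i) * frechet_derivative (f \<circ> inv_into U h) (at (h p)) i)"
proof -
  let ?F = "f \<circ> inv_into U h"
  obtain G where G: "\<And>i. smooth_on W (G i)"
    and FG: "\<And>x. x \<in> W \<Longrightarrow> ?F x = ?F (h p) + (\<Sum>i\<in>Basis. ((x - h p) \<bullet> i) * G i x)"
    and Gp: "\<And>i. G i (h p) = frechet_derivative ?F (at (h p)) i"
    using that by (rule hadamard[OF local_smooth[OF f]])
  define b where "b = extend (\<lambda>x. 1)"
  have b: "smooth_fun A b"
    unfolding b_def by (intro smooth_fun_extend smooth_on_const) simp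
  have b2: "smooth_fun A (\<lambda>q. b q * b q)"
    by (rule smooth_fun_mult[OF b b])
  have e: "smooth_fun A (extend (G i))" for i
    by (rule smooth_fun_extend[OF G])
  have ce: "smooth_fun A (\<lambda>q. coord i q * extend (G i) q)" for i
    by (rule smooth_fun_mult[OF smooth_fun_coord e])
  have sum: "smooth_fun A (\<lambda>q. \<Sum>i\<in>Basis. coord i q * extend (G i) q)"
    by (rule smooth_fun_sum[OF finite_Basis ce])
  have sum_eq: "v (\<lambda>q. \<Sum>i\<in>Basis. coord i q * extend (G i) q) =
      (\<Sum>i\<in>Basis. v (\<lambda>q. coord i q * extend (G i) q))"
    by (rule tangent_sum[OF v finite_Basis ce])
  \<comment> \<open>Hadamard's expansion holds only on the ball. Multiplied by the square of the
    cut-off it holds everywhere: one factor goes into \<open>coord i\<close>, the other into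
    \<open>extend (G i)\<close>. As \<open>b p = 1\<close>, the terms with
    \<open>v (\<lambda>q. b q * b q)\<close> cancel afterwards.\<close>
  have "f q * (b q * b q) = f p * (b q * b q) + (\<Sum>i\<in>Basis. coord i q * extend (G i) q)" for q
  proof (cases "q \<in> U \<and> h q \<in> W")
    case True
    then have "f q = f p + (\<Sum>i\<in>Basis. ((h q - h p) \<bullet> i) * G i (h q))"
      using FG[of "h q"] by (simp add: chart_inverse[OF chart] p_in_U del: mem_ball)
    then show ?thesis
      using True by (simp add: b_def coord_def extend_def algebra_simps sum_distrib_left sum_distrib_right
          del: mem_ball)
  qed (auto simp: b_def coord_def extend_def)
  then have "v (\<lambda>q. f q * (b q * b q)) =
      v (\<lambda>q. f p * (b q * b q) + (\<Sum>i\<in>Basis. coord i q * extend (G i) q))"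
    by simp
  moreover have "v (\<lambda>q. f q * (b q * b q)) = f p * v (\<lambda>q. b q * b q) + v f"
    using tangent_mult[OF v f b2] by (simp add: b_def extend_center)
  moreover have "v (\<lambda>q. f p * (b q * b q) + (\<Sum>i\<in>Basis. coord i q * extend (G i) q)) =
      f p * v (\<lambda>q. b q * b q) + (\<Sum>i\<in>Basis. v (\<lambda>q. coord i q * extend (G i) q))"
    unfolding tangent_add[OF v smooth_fun_cmult[OF b2] sum] tangent_cmult[OF v b2] sum_eq ..
  moreover have "v (\<lambda>q. coord i q * extend (G i) q) = v (coord i) * frechet_derivative ?F (at (h p)) i" for i
    using tangent_mult[OF v smooth_fun_coord e] by (simp add: coord_def extend_center Gp)
  ultimately show ?thesis by simp
qed

lemma tangent_eq_coord_field:
  assumes v: "v \<in> tangent_space A p"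
  shows "\<exists>w. coord_field w p = v"
proof
  \<comment> \<open>The components of \<open>v\<close> in the chart are its values on the coordinate
    functions, by \<open>tangent_eq_sum_coord\<close>.\<close>
  let ?w = "\<Sum>i\<in>Basis. v (coord i) *\<^sub>R i"
  show "coord_field ?w p = v"
  proof
    fix f
    show "coord_field ?w p f = v f"
    proof (cases "smooth_fun A f")
      case True
      let ?D = "frechet_derivative (f \<circ> inv_into U h) (at (h p))"
      have "linear ?D"
        using smooth_on_has_derivative[OF local_smooth[OF True], of "h p"] r_pos
        by (intro has_derivative_linear) auto
      then show ?thesis
        using True tangent_eq_sum_coord[OF v True]
        by (simp add: coord_field_def extend_center linear_sum linear_cmul)
    qed (simp add: coord_field_def tangent_not_smooth[OF v])
  qed
qed

end

section \<open>Extending tangent vectors to global vector fields\<close>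

context manifold
begin

lemma chart_ballE:
  obtains U h r where "chart_ball A U h p r"
proof -
  have "p \<in> (\<Union>(U, h)\<in>A. U)"
    using manifold unfolding smooth_manifold_def by simp
  then obtain U h where U: "(U, h) \<in> A" "p \<in> U" by blast
  then obtain r where "r > 0" "ball (h p) r \<subseteq> h ` U"
    using chart_open[OF U(1)] by (meson imageI openE)
  with U have "chart_ball A U h p r"
    by unfold_locales
  then show thesis by (rule that)
qed

lemma extend_tangent:
  assumes "v \<in> tangent_space A p"
  obtains X where "vector_field A X" "X p = v"
proof -
  obtain U h r where "chart_ball A U h p r" by (rule chart_ballE)
  then interpret chart_ball A U h p r .
  show thesis
    using tangent_eq_coord_field[OF assms] vector_field_coord_field that by blast
qed

text \<open>The vector \<open>v\<close> is the value of a coordinate field with some direction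
  \<open>w0\<close>. In dimension at least 2 there is a direction \<open>w\<close> off the line of
  \<open>w0\<close>, and the coordinates tell the two fields apart at \<open>p\<close>.\<close>

lemma vector_field_not_multiple:
  assumes v: "v \<in> tangent_space A p" and dim: "DIM('e) \<ge> 2"
  obtains X where "vector_field A X" "\<And>c. X p \<noteq> tscale c v"
proof -
  obtain U h r where "chart_ball A U h p r" by (rule chart_ballE)
  then interpret chart_ball A U h p r .
  obtain w0 where w0: "coord_field w0 p = v"
    using tangent_eq_coord_field[OF v] by blast
  have "span {w0} \<noteq> UNIV"
  proof
    assume "span {w0} = UNIV"
    then have "DIM('e) \<le> card {w0}"
      using span_card_ge_dim[of "{w0}" UNIV] by simp
    with dim show False by simp
  qed
  then obtain w where w: "w \<notin> span {w0}" by blast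
  show thesis
  proof
    show "vector_field A (coord_field w)" by (rule vector_field_coord_field)
    show "coord_field w p \<noteq> tscale c v" for c
    proof
      assume "coord_field w p = tscale c v"
      then have "coord_field w p (coord i) = c * coord_field w0 p (coord i)" for i
        by (simp add: w0 tscale_def)
      then have "w = c *\<^sub>R w0"
        by (simp add: euclidean_eq_iff[of w] coord_field_coord)
      with w show False
        by (simp add: span_base span_mul)
    qed
  qed
qed

end

section \<open>Metric connections\<close>

text \<open>The basis in \<open>trace_on\<close> is chosen by \<open>SOME\<close>, so a basis of
  \<open>V\<close> has to be exhibited before the chosen set is known to lie in \<open>V\<close>,
  where \<open>L\<close> vanishes.\<close>

lemma trace_on_zero:
  assumes V: "tvec.subspace V" and L: "\<And>v. v \<in> V \<Longrightarrow> L v = 0"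
  shows "trace_on V L = 0"
proof -
  obtain B0 where "B0 \<subseteq> V" "tvec.independent B0" "V \<subseteq> tvec.span B0"
    using tvec.basis_exists[of V] by metis
  then have "tvec.independent B0 \<and> tvec.span B0 = V"
    using tvec.span_minimal[OF _ V] by blast
  then have B: "tvec.span (SOME B. tvec.independent B \<and> tvec.span B = V) = V"
    by (rule someI2) simp
  then have "L b = 0" if "b \<in> (SOME B. tvec.independent B \<and> tvec.span B = V)" for b
    using tvec.span_base[OF that] L by simp
  then show ?thesis
    by (simp add: trace_on_def Let_def tvec.representation_zero)
qed

context manifold
begin

lemma ricci_eq_0:
  assumes "\<And>X. vector_field A X \<Longrightarrow> curvature D X Y Z p = 0"
  shows "ricci A D Y Z p = 0"
  unfolding ricci_def
proof (rule trace_on_zero[OF subspace_tangent_space])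
  fix v assume "v \<in> tangent_space A p"
  then obtain X where "vector_field A X" "X p = v"
    by (rule extend_tangent)
  \<comment> \<open>The extension \<open>X\<close> of \<open>v\<close> supplies uniqueness for the
    \<open>THE\<close>: without any field through \<open>v\<close>, every \<open>w\<close> would
    qualify.\<close>
  with assms show "induced_endo A (\<lambda>X. curvature D X Y Z) p v = 0"
    unfolding induced_endo_def by (intro the_equality) auto
qed

end

section \<open>Identities for a metric connection with torsion\<close>

locale riemannian_connection = manifold A
  for A :: "('a::{t2_space, second_countable_topology}, 'e::euclidean_space) atlas" +
  fixes g :: "'a \<Rightarrow> 'a tvec \<Rightarrow> 'a tvec \<Rightarrow> real"
    and D :: "'a vfield \<Rightarrow> 'a vfield \<Rightarrow> 'a vfield"
  assumes metric: "riemannian_metric A g" and connection: "metric_connection A g D"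
begin

abbreviation vf :: "'a vfield \<Rightarrow> bool" where "vf \<equiv> vector_field A"

lemma g_commute: "u \<in> tangent_space A p \<Longrightarrow> v \<in> tangent_space A p \<Longrightarrow> g p u v = g p v u"
  and g_add_left: "u \<in> tangent_space A p \<Longrightarrow> v \<in> tangent_space A p \<Longrightarrow> w \<in> tangent_space A p \<Longrightarrow>
    g p (u + w) v = g p u v + g p w v"
  and g_scale_left: "u \<in> tangent_space A p \<Longrightarrow> v \<in> tangent_space A p \<Longrightarrow>
    g p (tscale c u) v = c * g p u v"
  and g_pos: "v \<in> tangent_space A p \<Longrightarrow> v \<noteq> 0 \<Longrightarrow> g p v v > 0"
  and smooth_fun_g: "vf X \<Longrightarrow> vf Y \<Longrightarrow> smooth_fun A (app2 g X Y)"
  using metric unfolding riemannian_metric_def by blast+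

lemma g_diff_left:
  assumes "u \<in> tangent_space A p" "v \<in> tangent_space A p" "w \<in> tangent_space A p"
  shows "g p (u - w) v = g p u v - g p w v"
  using g_add_left[OF tvec.subspace_diff[OF subspace_tangent_space assms(1,3)] assms(2,3)] by simp

lemma g_zero_left: "v \<in> tangent_space A p \<Longrightarrow> g p 0 v = 0"
  using g_scale_left[of v p v 0] by simp

lemma g_add_right: "u \<in> tangent_space A p \<Longrightarrow> v \<in> tangent_space A p \<Longrightarrow> w \<in> tangent_space A p \<Longrightarrow>
    g p v (u + w) = g p v u + g p v w"
  using g_add_left[of u p v w] tvec.subspace_add[OF subspace_tangent_space[of A p], of u w]
  by (simp add: g_commute[of v])

lemma g_diff_right: "u \<in> tangent_space A p \<Longrightarrow> v \<in> tangent_space A p \<Longrightarrow> w \<in> tangent_space A p \<Longrightarrow>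
    g p v (u - w) = g p v u - g p v w"
  using g_diff_left[of u p v w] tvec.subspace_diff[OF subspace_tangent_space[of A p], of u w]
  by (simp add: g_commute[of v])

lemma g_scale_right: "u \<in> tangent_space A p \<Longrightarrow> v \<in> tangent_space A p \<Longrightarrow>
    g p v (tscale c u) = c * g p v u"
  using g_scale_left[of u p v c] tvec.subspace_scale[OF subspace_tangent_space[of A p], of u c]
  by (simp add: g_commute[of v])

lemmas g_bilinear = g_add_left g_add_right g_diff_left g_diff_right g_scale_left g_scale_right
  tvec.subspace_add[OF subspace_tangent_space[of A]] tvec.subspace_diff[OF subspace_tangent_space[of A]]
  tvec.subspace_scale[OF subspace_tangent_space[of A]] vector_field_tangent[of A]

lemma g_eq_0_iff: "v \<in> tangent_space A p \<Longrightarrow> g p v v = 0 \<longleftrightarrow> v = 0"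
  using g_pos g_zero_left by fastforce

lemma vector_field_connection: "vf X \<Longrightarrow> vf Y \<Longrightarrow> vf (D X Y)"
  using connection unfolding metric_connection_def linear_connection_def by blast

lemma metric_compatible:
  "vf X \<Longrightarrow> vf Y \<Longrightarrow> vf Z \<Longrightarrow> along X (app2 g Y Z) = (\<lambda>p. app2 g (D X Y) Z p + app2 g Y (D X Z) p)"
  using connection unfolding metric_connection_def plus_fun_def by blast

lemma metric_compatible_at:
  "vf X \<Longrightarrow> vf Y \<Longrightarrow> vf Z \<Longrightarrow> X p (app2 g Y Z) = app2 g (D X Y) Z p + app2 g Y (D X Z) p"
  using metric_compatible[THEN fun_cong] by (simp add: along_apply)

lemma vector_field_curvature: "vf X \<Longrightarrow> vf Y \<Longrightarrow> vf Z \<Longrightarrow> vf (curvature D X Y Z)"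
  unfolding curvature_def
  by (intro vector_field_diff vector_field_connection vector_field_bracket)

text \<open>Differentiate \<open>app2 g Z W\<close> along \<open>X\<close> and \<open>Y\<close> in
  both orders; the difference is its derivative along the bracket. Metric compatibility expands all
  three terms, and the mixed products of first derivatives cancel. The argument is independent of
  the torsion.\<close>

lemma curvature_skew:
  assumes X: "vf X" and Y: "vf Y" and Z: "vf Z" and W: "vf W"
  shows "app2 g (curvature D X Y Z) W p = - app2 g Z (curvature D X Y W) p"
proof -
  have second: "X p (along Y (app2 g Z W)) = app2 g (D X (D Y Z)) W p + app2 g (D Y Z) (D X W) p
      + (app2 g (D X Z) (D Y W) p + app2 g Z (D X (D Y W)) p)" if "vf X" "vf Y" for X Y
    unfolding metric_compatible[OF that(2) Z W] using that Z W
    by (simp add: tangent_add[OF vector_field_tangent] smooth_fun_g vector_field_connection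
        metric_compatible_at)
  have "bracket X Y p (app2 g Z W) = app2 g (D (bracket X Y) Z) W p + app2 g Z (D (bracket X Y) W) p"
    by (rule metric_compatible_at[OF vector_field_bracket[OF X Y] Z W])
  moreover have "bracket X Y p (app2 g Z W) = X p (along Y (app2 g Z W)) - Y p (along X (app2 g Z W))"
    by (simp add: bracket_def)
  ultimately show ?thesis
    using second[OF X Y] second[OF Y X] X Y Z W
    by (simp add: curvature_def app2_def g_bilinear vector_field_connection vector_field_bracket)
qed

lemma curvature_skew_same:
  assumes "vf X" "vf Y" "vf Z"
  shows "app2 g (curvature D X Y Z) Z p = 0"
  using curvature_skew[OF assms assms(3), of p] assms
  by (simp add: app2_def g_commute[of "Z p"] vector_field_tangent vector_field_curvature)

text \<open>Swap the arguments of \<open>D\<close> at the cost of bracket and torsion, then use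
  metric compatibility. The first three terms on the right form the Lie derivative of
  \<open>g\<close> along \<open>Z\<close> and do not involve \<open>D\<close>, so two metric
  connections can be compared through their torsions alone.\<close>

lemma symmetrized_derivative:
  assumes X: "vf X" and Y: "vf Y" and Z: "vf Z"
  shows "app2 g (D X Z) Y p + app2 g X (D Y Z) p =
    Z p (app2 g X Y) - app2 g (bracket Z X) Y p - app2 g X (bracket Z Y) p
      - app2 g (torsion D Z X) Y p - app2 g X (torsion D Z Y) p"
  using metric_compatible_at[OF Z X Y, of p] assms
  by (simp add: torsion_def app2_def g_bilinear vector_field_connection vector_field_bracket)

end


section \<open>Kenmotsu manifolds\<close>

locale kenmotsu_connection =
  fixes A :: "('a::{t2_space, second_countable_topology}, 'e::euclidean_space) atlas"
    and \<phi> :: "'a \<Rightarrow> 'a tvec \<Rightarrow> 'a tvec"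
    and \<xi> :: "'a vfield"
    and \<eta> :: "'a \<Rightarrow> 'a tvec \<Rightarrow> real"
    and g :: "'a \<Rightarrow> 'a tvec \<Rightarrow> 'a tvec \<Rightarrow> real"
    and \<alpha> \<beta> :: "'a \<Rightarrow> real"
    and D :: "'a vfield \<Rightarrow> 'a vfield \<Rightarrow> 'a vfield"
  assumes kenmotsu: "kenmotsu A \<phi> \<xi> \<eta> g"
    and gsm: "generalized_symmetric_metric_connection A \<phi> \<eta> g \<alpha> \<beta> D"

sublocale kenmotsu_connection \<subseteq> riemannian_connection A g D
  using kenmotsu gsm
  by unfold_locales
    (auto simp: kenmotsu_def almost_contact_metric_def generalized_symmetric_metric_connection_def)

context kenmotsu_connection
begin

lemma contact: "almost_contact_metric A \<phi> \<xi> \<eta> g"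
  using kenmotsu by (simp add: kenmotsu_def)

lemma vf_\<xi>: "vf \<xi>"
  using contact by (simp add: almost_contact_metric_def)

lemma vf_\<phi>: "vf X \<Longrightarrow> vf (app \<phi> X)"
  using contact by (simp add: almost_contact_metric_def tensor11_def)

lemma \<eta>_\<xi>: "app \<eta> \<xi> p = 1"
  using contact by (simp add: almost_contact_metric_def one_fun_def)

lemma \<phi>_\<xi>: "app \<phi> \<xi> = 0"
  using contact by (simp add: almost_contact_metric_def)

lemma g_\<xi>: "vf X \<Longrightarrow> app2 g X \<xi> p = app \<eta> X p"
  using contact by (simp add: almost_contact_metric_def)

lemma g_\<xi>': "vf X \<Longrightarrow> app2 g \<xi> X p = app \<eta> X p"
  using g_\<xi>[of X p] g_commute[of "X p" p "\<xi> p"] vf_\<xi> by (simp add: app2_def vector_field_tangent)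

text \<open>Insert \<open>X\<close> and \<open>app \<phi> Y\<close> into the compatibility of
  \<open>g\<close> with \<open>\<phi>\<close>: the square of \<open>\<phi>\<close> turns the left
  side into minus the desired product, because the image of \<open>\<phi>\<close> is orthogonal to
  \<open>\<xi>\<close>.\<close>

lemma \<phi>_skew:
  assumes X: "vf X" and Y: "vf Y"
  shows "app2 g (app \<phi> X) Y p = - app2 g X (app \<phi> Y) p"
proof -
  have \<eta>\<phi>: "app \<eta> (app \<phi> Z) p = 0" if "vf Z" for Z
    using contact that by (simp add: almost_contact_metric_def)
  have "app2 g (app \<phi> X) (app \<phi> (app \<phi> Y)) p = app2 g X (app \<phi> Y) p"
    using contact X vf_\<phi>[OF Y] \<eta>\<phi>[OF Y] by (simp add: almost_contact_metric_def)
  moreover have "app \<phi> (app \<phi> Y) p = tscale (app \<eta> Y p) (\<xi> p) - Y p"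
    using contact Y by (simp add: almost_contact_metric_def smul_def)
  ultimately show ?thesis
    using g_\<xi>[OF vf_\<phi>[OF X], of p] \<eta>\<phi>[OF X] X Y vf_\<phi>[OF X] vf_\<xi>
    by (simp add: app2_def g_bilinear)
qed

text \<open>Compare \<open>D\<close> with the Levi-Civita connection by
  \<open>symmetrized_derivative\<close>. The latter contributes the 1 in
  \<open>1 + \<alpha> p\<close>, the torsion of \<open>D\<close> contributes
  \<open>\<alpha> p\<close>, and its \<open>\<beta>\<close>-part drops out since
  \<open>\<phi>\<close> is skew.\<close>

lemma derivative_\<xi>:
  assumes X: "vf X" and Y: "vf Y"
  shows "app2 g (D X \<xi>) Y p + app2 g X (D Y \<xi>) p =
    2 * (1 + \<alpha> p) * (app2 g X Y p - app \<eta> X p * app \<eta> Y p)"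
proof -
  obtain L where L: "levi_civita A g L" and L_\<xi>: "\<And>X. vf X \<Longrightarrow> L X \<xi> = X - app \<eta> X \<odot> \<xi>"
    using kenmotsu unfolding kenmotsu_def by blast
  interpret L: riemannian_connection A g L
    using L metric by unfold_locales (auto simp: levi_civita_def)
  have torsion_L: "torsion L \<xi> Z = 0" if "vf Z" for Z
    using L that vf_\<xi> by (simp add: levi_civita_def)
  have "torsion D \<xi> Z = \<alpha> \<odot> (app \<eta> Z \<odot> \<xi> - app \<eta> \<xi> \<odot> Z)
      + \<beta> \<odot> (app \<eta> Z \<odot> app \<phi> \<xi> - app \<eta> \<xi> \<odot> app \<phi> Z)" if "vf Z" for Z
    using gsm that vf_\<xi> by (simp add: generalized_symmetric_metric_connection_def)
  then have torsion_D: "torsion D \<xi> Z p =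
      tscale (\<alpha> p) (tscale (app \<eta> Z p) (\<xi> p) - Z p) - tscale (\<beta> p) (app \<phi> Z p)" if "vf Z" for Z
    using that by (simp add: smul_def \<eta>_\<xi> \<phi>_\<xi> tvec.scale_right_diff_distrib)
  have at: "Z p \<in> tangent_space A p" if "vf Z" for Z
    using that by (rule vector_field_tangent)
  have "app2 g (L X \<xi>) Y p + app2 g X (L Y \<xi>) p = 2 * (app2 g X Y p - app \<eta> X p * app \<eta> Y p)"
    using g_\<xi>[OF X, of p] g_\<xi>'[OF Y, of p] X Y vf_\<xi>
    by (simp add: L_\<xi> smul_def app2_def g_bilinear)
  moreover have "app2 g (torsion D \<xi> X) Y p + app2 g X (torsion D \<xi> Y) p =
      - 2 * \<alpha> p * (app2 g X Y p - app \<eta> X p * app \<eta> Y p)"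
    using g_\<xi>[OF X, of p] g_\<xi>'[OF Y, of p] \<phi>_skew[OF X Y, of p] X Y vf_\<xi> vf_\<phi>
    by (simp add: torsion_D app2_def g_bilinear algebra_simps)
  moreover have "app2 g (torsion L \<xi> X) Y p = 0" "app2 g X (torsion L \<xi> Y) p = 0"
    using g_zero_left[OF at[OF X]] g_zero_left[OF at[OF Y]]
      g_commute[OF at[OF X] tvec.subspace_0[OF subspace_tangent_space]]
    by (simp_all add: torsion_L X Y app2_def)
  ultimately show ?thesis
    using symmetrized_derivative[OF X Y vf_\<xi>, of p] L.symmetrized_derivative[OF X Y vf_\<xi>, of p]
    by (simp add: algebra_simps)
qed

section \<open>Steady solitons and the contradiction\<close>

lemma ricci_steady:
  assumes "ricci_soliton A \<xi> \<eta> g D 0" and X: "vf X" and Y: "vf Y"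
  shows "ricci A D X Y p = - (1 + \<alpha> p) * (app2 g X Y p - app \<eta> X p * app \<eta> Y p)"
proof -
  have "2 * ricci A D X Y p = - (app2 g (D X \<xi>) Y p + app2 g X (D Y \<xi>) p)"
    using assms by (simp add: ricci_soliton_def eta_ricci_soliton_def)
  then show ?thesis
    unfolding derivative_\<xi>[OF X Y] by (simp add: algebra_simps)
qed

lemma ricci_steady_definite:
  assumes steady: "ricci_soliton A \<xi> \<eta> g D 0" and "\<alpha> p \<noteq> - 1"
    and V: "vf V" and "app \<eta> V p = 0" "ricci A D V V p = 0"
  shows "V p = 0"
  using ricci_steady[OF steady V V, of p] assms g_eq_0_iff[OF vector_field_tangent[OF V]]
  by (simp add: app2_def)

lemma curvature_eq_0:
  assumes steady: "ricci_soliton A \<xi> \<eta> g D 0" and \<alpha>: "\<alpha> p \<noteq> - 1"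
    and dot: "ricci_dot_curvature_zero A \<xi> D"
    and Y: "vf Y" and Z: "vf Z" and W: "vf W"
  shows "curvature D Y Z W p = 0"
proof -
  let ?R = "curvature D" and ?S = "ricci A D"
  have S_\<xi>: "?S \<xi> V p = 0" if "vf V" for V
    using ricci_steady[OF steady vf_\<xi> that, of p] by (simp add: g_\<xi>' that \<eta>_\<xi>)
  have R: "vf (?R X Y Z)" if "vf X" "vf Y" "vf Z" for X Y Z
    using that by (rule vector_field_curvature)
  have R_\<xi>: "g p (?R X Y \<xi> p) (\<xi> p) = 0" if "vf X" "vf Y" for X Y
    using curvature_skew_same[OF that vf_\<xi>, of p] by (simp add: app2_def)
  have \<xi>\<xi>: "g p (\<xi> p) (\<xi> p) = 1"
    using g_\<xi>[OF vf_\<xi>, of p] by (simp add: app2_def \<eta>_\<xi>)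
  \<comment> \<open>Pairing the condition with \<open>\<xi>\<close> leaves three of its eight terms:
    four carry a factor \<open>?S \<xi> _\<close>, which is 0, and \<open>?R Y Z \<xi>\<close> is
    orthogonal to \<open>\<xi>\<close>.\<close>
  have \<xi>_component: "?S X (?R Y Z W) p + ?S X Y p * g p (?R \<xi> Z W p) (\<xi> p)
      + ?S X Z p * g p (?R Y \<xi> W p) (\<xi> p) = 0"
    if X: "vf X" and Y: "vf Y" and Z: "vf Z" and W: "vf W" for X Y Z W
  proof -
    have "(?S X (?R Y Z W) \<odot> \<xi> - ?S \<xi> (?R Y Z W) \<odot> X
        + ?S X Y \<odot> ?R \<xi> Z W - ?S \<xi> Y \<odot> ?R X Z W
        + ?S X Z \<odot> ?R Y \<xi> W - ?S \<xi> Z \<odot> ?R Y X W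
        + ?S X W \<odot> ?R Y Z \<xi> - ?S \<xi> W \<odot> ?R Y Z X) p = 0"
      using dot X Y Z W unfolding ricci_dot_curvature_zero_def Let_def by (metis zero_fun_apply)
    then have "tscale (?S X (?R Y Z W) p) (\<xi> p) + tscale (?S X Y p) (?R \<xi> Z W p)
        + tscale (?S X Z p) (?R Y \<xi> W p) + tscale (?S X W p) (?R Y Z \<xi> p) = 0"
      by (simp add: smul_def S_\<xi> R X Y Z W)
    from arg_cong[OF this, of "\<lambda>v. g p v (\<xi> p)"] show ?thesis
      using X Y Z W vf_\<xi> R
      by (simp add: g_bilinear g_zero_left R_\<xi> \<xi>\<xi>)
  qed
  \<comment> \<open>Choosing \<open>X\<close> as \<open>?R Y Z W\<close> itself in
    \<open>\<xi>_component\<close>, hypothesis \<open>*\<close> removes the last two terms, and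
    definiteness applies. It is used first for \<open>W = \<xi>\<close>, where \<open>*\<close> is
    \<open>R_\<xi>\<close>; by skew-symmetry this yields \<open>*\<close> for general
    \<open>W\<close>.\<close>
  have zero: "?R Y Z W p = 0"
    if Y: "vf Y" and Z: "vf Z" and W: "vf W"
      and *: "\<And>X Y. vf X \<Longrightarrow> vf Y \<Longrightarrow> g p (?R X Y W p) (\<xi> p) = 0" for Y Z W
  proof (rule ricci_steady_definite[OF steady \<alpha> R[OF Y Z W]])
    show "app \<eta> (?R Y Z W) p = 0"
      using *[OF Y Z] g_\<xi>[OF R[OF Y Z W], of p] by (simp add: app2_def)
    show "?S (?R Y Z W) (?R Y Z W) p = 0"
      using \<xi>_component[OF R[OF Y Z W] Y Z W] *[OF vf_\<xi> Z] *[OF Y vf_\<xi>] by simp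
  qed
  show ?thesis
  proof (rule zero[OF Y Z W])
    fix X Y assume XY: "vf X" "vf Y"
    have "?R X Y \<xi> p = 0"
      by (rule zero[OF XY vf_\<xi> R_\<xi>])
    then show "g p (?R X Y W p) (\<xi> p) = 0"
      using curvature_skew[OF XY W vf_\<xi>, of p] g_zero_left[OF vector_field_tangent[OF W], of p]
        g_commute[OF vector_field_tangent[OF W] tvec.subspace_0[OF subspace_tangent_space], of p]
      by (simp add: app2_def)
  qed
qed

lemma not_steady:
  assumes dim: "DIM('e) \<ge> 2" and \<alpha>: "\<alpha> \<noteq> (\<lambda>p. - 1)"
    and dot: "ricci_dot_curvature_zero A \<xi> D"
  shows "\<not> ricci_soliton A \<xi> \<eta> g D 0"
proof
  assume steady: "ricci_soliton A \<xi> \<eta> g D 0"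
  \<comment> \<open>The functions may differ at a single point only; the rest of the argument is
    pointwise at \<open>p\<close>.\<close>
  obtain p where p: "\<alpha> p \<noteq> - 1"
    using \<alpha> by blast
  obtain X where X: "vf X" and X_\<xi>: "\<And>c. X p \<noteq> tscale c (\<xi> p)"
    using vector_field_not_multiple[OF vector_field_tangent[OF vf_\<xi>] dim] by metis
  have "curvature D Y X X p = 0" if "vf Y" for Y
    by (rule curvature_eq_0[OF steady p dot that X X])
  then have "ricci A D X X p = 0"
    by (rule ricci_eq_0)
  then have "app2 g X X p = app \<eta> X p * app \<eta> X p"
    using ricci_steady[OF steady X X, of p] p by simp
  moreover have "g p (\<xi> p) (\<xi> p) = 1"
    using g_\<xi>[OF vf_\<xi>, of p] by (simp add: app2_def \<eta>_\<xi>)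
  \<comment> \<open>This is the equality case of Cauchy-Schwarz for \<open>X p\<close> and the unit
    vector \<open>\<xi> p\<close>, which forces \<open>X p\<close> to be a multiple of
    \<open>\<xi> p\<close>.\<close>
  ultimately have "g p (X p - tscale (app \<eta> X p) (\<xi> p)) (X p - tscale (app \<eta> X p) (\<xi> p)) = 0"
    using g_\<xi>[OF X, of p] g_\<xi>'[OF X, of p] X vf_\<xi>
    by (simp add: app2_def g_bilinear algebra_simps)
  then have "X p - tscale (app \<eta> X p) (\<xi> p) = 0"
    by (subst (asm) g_eq_0_iff) (simp_all add: g_bilinear X vf_\<xi>)
  with X_\<xi> show False by simp
qed

end

theorem corollary8p2:
  fixes A :: "('a::{t2_space, second_countable_topology}, 'e::euclidean_space) atlas"
    and \<phi> :: "'a \<Rightarrow> 'a tvec \<Rightarrow> 'a tvec"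
    and \<xi> :: "'a vfield"
    and \<eta> :: "'a \<Rightarrow> 'a tvec \<Rightarrow> real"
    and g :: "'a \<Rightarrow> 'a tvec \<Rightarrow> 'a tvec \<Rightarrow> real"
    and \<alpha> \<beta> :: "'a \<Rightarrow> real"
    and D :: "'a vfield \<Rightarrow> 'a vfield \<Rightarrow> 'a vfield"
  assumes "kenmotsu A \<phi> \<xi> \<eta> g"
    and "DIM('e) \<ge> 3"
    and "generalized_symmetric_metric_connection A \<phi> \<eta> g \<alpha> \<beta> D"
    and "\<alpha> \<noteq> (\<lambda>p. - 1)"
    and "ricci_dot_curvature_zero A \<xi> D"
  shows "\<forall>l. ricci_soliton A \<xi> \<eta> g D l \<longrightarrow>
           shrinking_ricci_soliton A \<xi> \<eta> g D l \<or> expanding_ricci_soliton A \<xi> \<eta> g D l"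
proof -
  interpret kenmotsu_connection A \<phi> \<xi> \<eta> g \<alpha> \<beta> D
    using assms(1,3) by unfold_locales
  have "\<not> ricci_soliton A \<xi> \<eta> g D 0"
    using assms by (intro not_steady) auto
  then have "l \<noteq> 0" if "ricci_soliton A \<xi> \<eta> g D l" for l
    using that by metis
  then show ?thesis
    unfolding shrinking_ricci_soliton_def expanding_ricci_soliton_def
    by (metis linorder_neqE_linordered_idom)
qed

end
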